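(* Let $(\Omega,\Sigma,\mu)$ be an atomless probability space, let $T:\Omega\to\Omega$ be an invertible measure-preserving transformation, and let $(a_k)_{k\in\mathbb{Z}}$ be a sequence of positive real numbers with $\sum_{k\in\mathbb{Z}}a_k=1$ and $\sum_{k\in\mathbb{Z}}\sqrt{a_k}<\infty$. Let $X=(L_1(\mu),|||\cdot|||)$, where $$|||f|||=\int_\Omega\Big(\sum_{k\in\mathbb{Z}}a_k|f(T^k\omega)|^2\Big)^{1/2}d\mu(\omega).$$ Then the dual space $X^*=(L_\infty(\mu),|||\cdot|||_* )$ has the Daugavet property.
   Context: $L_1(\mu)$ is over $\mathbb{K}=\mathbb{R}$ or $\mathbb{C}$. An invertible measure-preserving transformation is a bijection $T:\Omega\to\Omega$ such that $T$ and $T^{-1}$ are measurable and $\mu(T^{-1}(A))=\mu(A)$ for every $A\in\Sigma$. The functional $|||\cdot|||$ is an equivalent norm on $L_1(\mu)$, with $\|f\|_1\le|||f|||\le(\sum_{k}\sqrt{a_k})\|f\|_1$. The dual $X^*$ is identified as a vector space with $L_\infty(\mu)$ via $\Phi(f)=\int_\Omega\Phi f\,d\mu$, and $|||\Phi|||_*=\sup_{|||f|||\le1}|\Phi(f)|$ is the dual norm. A Banach space $Y$ has the Daugavet property if $\|I+R\|=1+\|R\|$ for every rank-one bounded linear operator $R:Y\to Y$, where $I$ is the identity of $Y$. *)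

theory Defs
  imports "HOL-Probability.Probability"
begin

section \<open>Normed spaces on a carrier and the Daugavet property\<close>

text \<open>The space \<open>L\<^sub>\<infinity>(\<mu>)\<close> depends on the measure, which is a term, so it is not a type of class
  \<open>banach\<close>. Normed spaces are therefore given by an explicit carrier and explicit operations.\<close>

record ('k, 'v) normed_structure =
  vcarrier :: "'v set"
  vzero :: "'v"
  vadd :: "'v \<Rightarrow> 'v \<Rightarrow> 'v"
  vscale :: "'k \<Rightarrow> 'v \<Rightarrow> 'v"
  vnorm :: "'v \<Rightarrow> real"

definition vector_space_on :: "('k::real_normed_field, 'v) normed_structure \<Rightarrow> bool" where
  "vector_space_on Y \<longleftrightarrow>
     vzero Y \<in> vcarrier Y \<and>
     (\<forall>x\<in>vcarrier Y. \<forall>y\<in>vcarrier Y. vadd Y x y \<in> vcarrier Y) \<and>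
     (\<forall>c. \<forall>x\<in>vcarrier Y. vscale Y c x \<in> vcarrier Y) \<and>
     (\<forall>x\<in>vcarrier Y. \<forall>y\<in>vcarrier Y. \<forall>z\<in>vcarrier Y.
        vadd Y (vadd Y x y) z = vadd Y x (vadd Y y z)) \<and>
     (\<forall>x\<in>vcarrier Y. \<forall>y\<in>vcarrier Y. vadd Y x y = vadd Y y x) \<and>
     (\<forall>x\<in>vcarrier Y. vadd Y (vzero Y) x = x) \<and>
     (\<forall>x\<in>vcarrier Y. vadd Y x (vscale Y (- 1) x) = vzero Y) \<and>
     (\<forall>c. \<forall>x\<in>vcarrier Y. \<forall>y\<in>vcarrier Y.
        vscale Y c (vadd Y x y) = vadd Y (vscale Y c x) (vscale Y c y)) \<and>
     (\<forall>c d. \<forall>x\<in>vcarrier Y. vscale Y (c + d) x = vadd Y (vscale Y c x) (vscale Y d x)) \<and>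
     (\<forall>c d. \<forall>x\<in>vcarrier Y. vscale Y (c * d) x = vscale Y c (vscale Y d x)) \<and>
     (\<forall>x\<in>vcarrier Y. vscale Y 1 x = x)"

definition normed_space_on :: "('k::real_normed_field, 'v) normed_structure \<Rightarrow> bool" where
  "normed_space_on Y \<longleftrightarrow>
     vector_space_on Y \<and>
     (\<forall>x\<in>vcarrier Y. 0 \<le> vnorm Y x) \<and>
     (\<forall>x\<in>vcarrier Y. vnorm Y x = 0 \<longleftrightarrow> x = vzero Y) \<and>
     (\<forall>c. \<forall>x\<in>vcarrier Y. vnorm Y (vscale Y c x) = norm c * vnorm Y x) \<and>
     (\<forall>x\<in>vcarrier Y. \<forall>y\<in>vcarrier Y. vnorm Y (vadd Y x y) \<le> vnorm Y x + vnorm Y y)"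

definition vdist :: "('k::real_normed_field, 'v) normed_structure \<Rightarrow> 'v \<Rightarrow> 'v \<Rightarrow> real" where
  "vdist Y x y = vnorm Y (vadd Y x (vscale Y (- 1) y))"

definition banach_space_on :: "('k::real_normed_field, 'v) normed_structure \<Rightarrow> bool" where
  "banach_space_on Y \<longleftrightarrow>
     normed_space_on Y \<and>
     (\<forall>u. range u \<subseteq> vcarrier Y \<and> (\<forall>e>0. \<exists>N. \<forall>m\<ge>N. \<forall>n\<ge>N. vdist Y (u m) (u n) < e) \<longrightarrow>
        (\<exists>x\<in>vcarrier Y. (\<lambda>n::nat. vdist Y (u n) x) \<longlonglongrightarrow> 0))"

definition bounded_operator_on ::
    "('k::real_normed_field, 'v) normed_structure \<Rightarrow> ('v \<Rightarrow> 'v) \<Rightarrow> bool" where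
  "bounded_operator_on Y R \<longleftrightarrow>
     (\<forall>x\<in>vcarrier Y. R x \<in> vcarrier Y) \<and>
     (\<forall>x\<in>vcarrier Y. \<forall>y\<in>vcarrier Y. R (vadd Y x y) = vadd Y (R x) (R y)) \<and>
     (\<forall>c. \<forall>x\<in>vcarrier Y. R (vscale Y c x) = vscale Y c (R x)) \<and>
     (\<exists>C. \<forall>x\<in>vcarrier Y. vnorm Y (R x) \<le> C * vnorm Y x)"

definition rank_one_on ::
    "('k::real_normed_field, 'v) normed_structure \<Rightarrow> ('v \<Rightarrow> 'v) \<Rightarrow> bool" where
  "rank_one_on Y R \<longleftrightarrow>
     (\<exists>y\<in>vcarrier Y. y \<noteq> vzero Y \<and> R ` vcarrier Y = range (\<lambda>c. vscale Y c y))"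

definition operator_norm_on ::
    "('k::real_normed_field, 'v) normed_structure \<Rightarrow> ('v \<Rightarrow> 'v) \<Rightarrow> real" where
  "operator_norm_on Y R = (SUP x\<in>{x \<in> vcarrier Y. vnorm Y x \<le> 1}. vnorm Y (R x))"

definition daugavet_property :: "('k::real_normed_field, 'v) normed_structure \<Rightarrow> bool" where
  "daugavet_property Y \<longleftrightarrow>
     banach_space_on Y \<and>
     (\<forall>R. bounded_operator_on Y R \<and> rank_one_on Y R \<longrightarrow>
        operator_norm_on Y (\<lambda>x. vadd Y x (R x)) = 1 + operator_norm_on Y R)"

section \<open>Atomless measures and invertible measure-preserving transformations\<close>

definition atomless :: "'a measure \<Rightarrow> bool" where
  "atomless M \<longleftrightarrow>
     \<not> (\<exists>A\<in>sets M. 0 < emeasure M A \<and>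
          (\<forall>B\<in>sets M. B \<subseteq> A \<longrightarrow> emeasure M B = 0 \<or> emeasure M (A - B) = 0))"

definition invertible_mpt :: "'a measure \<Rightarrow> ('a \<Rightarrow> 'a) \<Rightarrow> bool" where
  "invertible_mpt M T \<longleftrightarrow>
     bij_betw T (space M) (space M) \<and>
     T \<in> measurable M M \<and>
     inv_into (space M) T \<in> measurable M M \<and>
     (\<forall>A\<in>sets M. emeasure M (T -` A \<inter> space M) = emeasure M A)"

definition int_iterate :: "'a measure \<Rightarrow> ('a \<Rightarrow> 'a) \<Rightarrow> int \<Rightarrow> 'a \<Rightarrow> 'a" where
  "int_iterate M T k =
     (if 0 \<le> k then T ^^ nat k else inv_into (space M) T ^^ nat (- k))"

section \<open>The renorming of \<open>L\<^sub>1(\<mu>)\<close> and its dual\<close>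

text \<open>For integrable \<open>f\<close> and \<open>\<Sum>k. sqrt (a k) < \<infinity>\<close> the inner series converges for almost every
  \<open>\<omega>\<close>; on the exceptional null set \<open>infsum\<close> returns 0, which does not affect the integral.\<close>

definition L1_renorm ::
    "'a measure \<Rightarrow> ('a \<Rightarrow> 'a) \<Rightarrow> (int \<Rightarrow> real) \<Rightarrow> ('a \<Rightarrow> 'k::real_normed_field) \<Rightarrow> real" where
  "L1_renorm M T a f =
     (\<integral>\<omega>. sqrt (\<Sum>\<^sub>\<infinity>k\<in>UNIV. a k * (norm (f (int_iterate M T k \<omega>)))\<^sup>2) \<partial>M)"

text \<open>The dual norm on representatives. The supremum is over integrable functions rather than over
  their classes in \<open>L\<^sub>1(\<mu>)\<close>; both \<open>L1_renorm\<close> and the pairing depend only on the class of \<open>f\<close>.\<close>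

definition dual_norm ::
    "'a measure \<Rightarrow> ('a \<Rightarrow> 'a) \<Rightarrow> (int \<Rightarrow> real) \<Rightarrow>
     ('a \<Rightarrow> 'k::{real_normed_field, banach, second_countable_topology}) \<Rightarrow> real" where
  "dual_norm M T a \<Phi> =
     (SUP f\<in>{f. integrable M f \<and> L1_renorm M T a f \<le> 1}. norm (\<integral>\<omega>. \<Phi> \<omega> * f \<omega> \<partial>M))"

definition ess_bounded :: "'a measure \<Rightarrow> ('a \<Rightarrow> 'k::real_normed_field) set" where
  "ess_bounded M = {\<Phi> \<in> borel_measurable M. \<exists>C. AE \<omega> in M. norm (\<Phi> \<omega>) \<le> C}"

definition ae_rel :: "'a measure \<Rightarrow> (('a \<Rightarrow> 'k::real_normed_field) \<times> ('a \<Rightarrow> 'k)) set" where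
  "ae_rel M = {(\<Phi>, \<Psi>). \<Phi> \<in> ess_bounded M \<and> \<Psi> \<in> ess_bounded M \<and> (AE \<omega> in M. \<Phi> \<omega> = \<Psi> \<omega>)}"

text \<open>The dual \<open>X\<^sup>* = (L\<^sub>\<infinity>(\<mu>), |||\<cdot>|||\<^sub>*)\<close>: its points are almost-everywhere classes, \<open>\<Phi>\<close> acting on
  \<open>L\<^sub>1(\<mu>)\<close> by \<open>f \<mapsto> \<integral> \<Phi> f d\<mu>\<close>. The operations are lifted to classes with the union idiom of
  \<open>HOL.Equiv_Relations\<close>.\<close>

definition dual_space ::
    "'a measure \<Rightarrow> ('a \<Rightarrow> 'a) \<Rightarrow> (int \<Rightarrow> real) \<Rightarrow>
     ('k::{real_normed_field, banach, second_countable_topology}, ('a \<Rightarrow> 'k) set) normed_structure"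
  where
  "dual_space M T a =
     \<lparr> vcarrier = ess_bounded M // ae_rel M,
       vzero = ae_rel M `` {\<lambda>\<omega>. 0},
       vadd = (\<lambda>A B. \<Union>\<Phi>\<in>A. \<Union>\<Psi>\<in>B. ae_rel M `` {\<lambda>\<omega>. \<Phi> \<omega> + \<Psi> \<omega>}),
       vscale = (\<lambda>c A. \<Union>\<Phi>\<in>A. ae_rel M `` {\<lambda>\<omega>. c * \<Phi> \<omega>}),
       vnorm = (\<lambda>A. the_elem (dual_norm M T a ` A)) \<rparr>"

end

theory Submission
  imports Defs
begin

text \<open>Write \<open>|||f||| = \<integral> S f d\<mu>\<close> with the square function
  \<open>S f = (\<Sum>k. a\<^sub>k |f \<circ> T\<^sup>k|\<^sup>2)\<^sup>1\<^sup>/\<^sup>2\<close>. It depends on \<open>|f|\<close> only, so the dual norm is a lattice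
  norm: \<open>|||\<Phi>|||\<^sub>*\<close> is the supremum of \<open>\<integral> |\<Phi>| p d\<mu>\<close> over densities \<open>p \<ge> 0\<close> with \<open>|||p||| \<le> 1\<close>.
  The classical proof that \<open>L\<^sub>\<infinity>\<close> has the Daugavet property changes a function on a tiny set, and uses
  that the \<open>L\<^sub>1\<close> norm is additive over a partition. The renorming is additive over partitions
  into invariant sets, but in general not over others, and an ergodic \<open>T\<close> has no invariant sets that
  are small but not null. However, it is almost additive for cutoffs \<open>u\<close> that vary slowly along orbits: for \<open>k\<close> in a finite set
  \<open>u \<circ> T\<^sup>k\<close> is close to \<open>u\<close>, and the remaining \<open>k\<close> contribute little because \<open>\<Sum>k. sqrt a\<^sub>k\<close>
  converges. This is \<open>renorm_mult_le\<close>, from which both local ingredients follow.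

  The first ingredient is \<open>norming_density_near_small_sets\<close>: every \<open>\<Psi>\<close> is almost normed by a density
  supported on boundedly many translates of an arbitrarily small set \<open>B\<close>. Start from an almost norming
  \<open>p\<close> and multiply by the number of visits of the orbit to \<open>B\<close> during a long time window. By
  invariance of \<open>\<mu>\<close> the gain becomes an integral over \<open>B\<close> of a function \<open>D\<close> with positive total
  integral, so any non-null \<open>B\<close> inside \<open>{D > 0}\<close> will do. The second is \<open>slow_cutoff_exists\<close>: a slowly
  varying \<open>u\<close> that is 1 on the support of that density and vanishes off a bounded number of
  translates of \<open>B\<close>, with \<open>|||u p||| + |||(1 - u) p||| \<le> (1 + \<epsilon>) |||p|||\<close> for all densities \<open>p\<close>.

  Now let the rank-one operator be \<open>\<Phi> \<mapsto> F(\<Phi>) \<Psi>\<close> with \<open>|||\<Psi>|||\<^sub>* = 1\<close>, let \<open>\<Phi>\<close> in the unit ball almost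
  norm \<open>F\<close>, and let \<open>c\<close> be the phase of \<open>F(\<Phi>)\<close>. The perturbation \<open>\<Phi>' = (1 - u) \<Phi> + u c \<Psi>\<close> has norm at
  most \<open>1 + \<epsilon>\<close> by the cutoff inequality, and where \<open>u = 1\<close> one has
  \<open>|\<Phi>' + F(\<Phi>) \<Psi>| = (1 + |F(\<Phi>)|) |\<Psi>|\<close>, so a density almost norming \<open>\<Psi>\<close> and supported there shows
  that \<open>|||\<Phi>' + F(\<Phi>) \<Psi>|||\<^sub>*\<close> is almost \<open>1 + |F(\<Phi>)|\<close>. It remains to see that \<open>F(\<Phi>')\<close> is close to
  \<open>F(\<Phi>)\<close>. The functional \<open>F\<close> need not be given by an \<open>L\<^sub>1\<close> function, so smallness of the support of
  \<open>u\<close> is not enough; instead take many sets \<open>B\<close> whose cutoffs have disjoint supports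
  (\<open>separated_subsets\<close>, where atomlessness enters). Since \<open>F\<close> is bounded on all signed
  sums of the disjoint pieces, it is small on at least one of them
  (\<open>functional_small_on_disjoint_cutoff\<close>). The estimate is assembled in \<open>daugavet_perturbation\<close>.

  Completeness of the dual holds because \<open>|||\<cdot>|||\<^sub>*\<close> is equivalent to the essential supremum norm.\<close>

section \<open>Nonnegative series\<close>

text \<open>Measurability and integration of series indexed by the integers are reduced to series of
  extended nonnegative reals over the naturals. For a divergent series \<open>infsum\<close> returns 0, and so does
  \<open>enn2real\<close> at infinity, so the equation covers divergent series as well.\<close>
lemma infsum_int_eq_suminf:
  fixes h :: "int \<Rightarrow> real"
  assumes "\<And>k. 0 \<le> h k"
  shows "h summable_on UNIV \<longleftrightarrow> summable (\<lambda>n. h (int_decode n))"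
    and "infsum h UNIV = enn2real (\<Sum>n. ennreal (h (int_decode n)))"
proof -
  have bij: "bij_betw int_decode UNIV UNIV"
    by (rule bij_int_decode)
  show eq: "h summable_on UNIV \<longleftrightarrow> summable (\<lambda>n. h (int_decode n))"
    using summable_on_reindex_bij_betw[OF bij, of h]
      summable_on_UNIV_nonneg_real_iff[of "\<lambda>n. h (int_decode n)"] assms by simp
  show "infsum h UNIV = enn2real (\<Sum>n. ennreal (h (int_decode n)))"
  proof (cases "summable (\<lambda>n. h (int_decode n))")
    case True
    have "infsum h UNIV = (\<Sum>\<^sub>\<infinity>n. h (int_decode n))"
      using infsum_reindex_bij_betw[OF bij, of h] by simp
    also have "\<dots> = (\<Sum>n. h (int_decode n))"
      using True assms by (intro infsumI norm_summable_imp_has_sum) (auto simp: summable_sums)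
    finally show ?thesis
      using True assms by (simp add: suminf_ennreal2 suminf_nonneg)
  next
    case False
    then have "(\<Sum>n. ennreal (h (int_decode n))) = \<top>"
      using summable_suminf_not_top[of "\<lambda>n. h (int_decode n)"] assms by blast
    then show ?thesis
      using False eq by (simp add: infsum_not_exists)
  qed
qed

lemma borel_measurable_infsum_int:
  fixes h :: "int \<Rightarrow> 'a \<Rightarrow> real"
  assumes [measurable]: "\<And>k. h k \<in> borel_measurable M" and "\<And>k x. 0 \<le> h k x"
  shows "(\<lambda>x. \<Sum>\<^sub>\<infinity>k\<in>UNIV. h k x) \<in> borel_measurable M"
  unfolding infsum_int_eq_suminf(2)[of "\<lambda>k. h k _", OF assms(2)] by measurable

lemma square_summable_nonneg:
  fixes b :: "'i \<Rightarrow> real"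
  assumes "b summable_on A" and "\<And>i. i \<in> A \<Longrightarrow> 0 \<le> b i"
  shows "(\<lambda>i. (b i)\<^sup>2) summable_on A" and "(\<Sum>\<^sub>\<infinity>i\<in>A. (b i)\<^sup>2) \<le> (\<Sum>\<^sub>\<infinity>i\<in>A. b i)\<^sup>2"
proof -
  have *: "(\<Sum>i\<in>F. (b i)\<^sup>2) \<le> (\<Sum>\<^sub>\<infinity>i\<in>A. b i)\<^sup>2" if F: "finite F" "F \<subseteq> A" for F
  proof -
    have "(\<Sum>i\<in>F. (b i)\<^sup>2) = (\<Sum>i\<in>F. b i * b i)"
      by (simp add: power2_eq_square)
    also have "\<dots> \<le> (\<Sum>i\<in>F. b i * (\<Sum>j\<in>F. b j))"
      using F assms(2) by (intro sum_mono mult_left_mono member_le_sum) auto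
    also have "\<dots> = (\<Sum>i\<in>F. b i)\<^sup>2"
      by (simp add: power2_eq_square sum_distrib_right)
    also have "\<dots> \<le> (\<Sum>\<^sub>\<infinity>i\<in>A. b i)\<^sup>2"
      using F assms by (intro power_mono finite_sum_le_infsum sum_nonneg) auto
    finally show ?thesis .
  qed
  show summ: "(\<lambda>i. (b i)\<^sup>2) summable_on A"
    using * by (intro nonneg_bdd_above_summable_on bdd_aboveI2) auto
  show "(\<Sum>\<^sub>\<infinity>i\<in>A. (b i)\<^sup>2) \<le> (\<Sum>\<^sub>\<infinity>i\<in>A. b i)\<^sup>2"
    using summ * by (rule infsum_le_finite_sums)
qed

section \<open>Phases of scalars\<close>

text \<open>The value at 0 is 1, and not 0, so that a phase always has norm 1: multiplying a density by a
  phase must not change its modulus anywhere.\<close>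
definition conj_phase :: "'k::real_normed_field \<Rightarrow> 'k" where
  "conj_phase z = (if z = 0 then 1 else of_real (norm z) / z)"

lemma norm_conj_phase [simp]: "norm (conj_phase z) = 1"
  by (simp add: conj_phase_def norm_divide)

lemma conj_phase_mult: "conj_phase z * z = of_real (norm z)"
  by (simp add: conj_phase_def)

lemma measurable_conj_phase [measurable]:
  "(conj_phase :: 'k::{real_normed_field, second_countable_topology} \<Rightarrow> 'k) \<in> borel_measurable borel"
  unfolding conj_phase_def[abs_def] divide_inverse by measurable

section \<open>The action of the integers\<close>

locale renormed_L1 = prob_space M for M :: "'a measure" +
  fixes T :: "'a \<Rightarrow> 'a" and a :: "int \<Rightarrow> real"
  assumes atomless: "atomless M" and mpt: "invertible_mpt M T"
    and a_pos: "\<And>k. 0 < a k"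
    and summable_sqrt: "(\<lambda>k. sqrt (a k)) summable_on UNIV"
begin

text \<open>The powers of \<open>T\<close> form a measure-preserving action of the integers, and the analysis below uses
  nothing else about \<open>T\<close>.\<close>
definition \<tau> :: "int \<Rightarrow> 'a \<Rightarrow> 'a" where "\<tau> k = int_iterate M T k"

lemma a_nonneg: "0 \<le> a k"
  using a_pos[of k] by simp

lemma bij_T: "bij_betw T (space M) (space M)"
  using mpt by (simp add: invertible_mpt_def)

lemma measurable_T: "T \<in> measurable M M" "inv_into (space M) T \<in> measurable M M"
  using mpt by (auto simp: invertible_mpt_def)

lemma distr_T: "distr M M T = M" "distr M M (inv_into (space M) T) = M"
proof -
  let ?S = "inv_into (space M) T"
  have pres: "emeasure M (T -` A \<inter> space M) = emeasure M A" if "A \<in> sets M" for A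
    using mpt that by (simp add: invertible_mpt_def)
  show "distr M M T = M"
    by (rule measure_eqI) (auto simp: emeasure_distr measurable_T pres)
  show "distr M M ?S = M"
  proof (rule measure_eqI)
    fix A assume "A \<in> sets (distr M M ?S)"
    then have A: "A \<in> sets M" by simp
    have "T -` (?S -` A \<inter> space M) \<inter> space M = A"
      using sets.sets_into_space[OF A] bij_T
      by (auto simp: bij_betw_def dest: measurable_space[OF measurable_T(1)])
    then show "emeasure (distr M M ?S) A = emeasure M A"
      using pres[of "?S -` A \<inter> space M"] A measurable_sets[OF measurable_T(2) A]
      by (simp add: emeasure_distr measurable_T)
  qed simp
qed

lemma tau_zero: "\<tau> 0 \<omega> = \<omega>"
  by (simp add: \<tau>_def int_iterate_def)

lemma funpow_space: "f \<in> measurable M M \<Longrightarrow> \<omega> \<in> space M \<Longrightarrow> (f ^^ n) \<omega> \<in> space M"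
  by (induction n) (auto dest: measurable_space)

lemma tau_step:
  assumes "\<omega> \<in> space M"
  shows "\<tau> (k + 1) \<omega> = T (\<tau> k \<omega>)" and "\<tau> (k - 1) \<omega> = inv_into (space M) T (\<tau> k \<omega>)"
proof -
  let ?S = "inv_into (space M) T"
  have TS: "T (?S x) = x" "?S (T x) = x" if "x \<in> space M" for x
    using bij_T that by (auto simp: bij_betw_def f_inv_into_f)
  show "\<tau> (k + 1) \<omega> = T (\<tau> k \<omega>)"
  proof (cases "0 \<le> k")
    case True
    then show ?thesis
      by (simp add: \<tau>_def int_iterate_def nat_add_distrib)
  next
    case False
    then have "nat (- k) = Suc (nat (- (k + 1)))" by simp
    moreover have "(?S ^^ nat (- (k + 1))) \<omega> \<in> space M"
      using assms by (intro funpow_space measurable_T)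
    ultimately show ?thesis
      using False by (cases "k = -1") (auto simp: \<tau>_def int_iterate_def TS assms)
  qed
  show "\<tau> (k - 1) \<omega> = ?S (\<tau> k \<omega>)"
  proof (cases "0 < k")
    case True
    then have "nat k = Suc (nat (k - 1))" by simp
    moreover have "(T ^^ nat (k - 1)) \<omega> \<in> space M"
      using assms by (intro funpow_space measurable_T)
    ultimately show ?thesis
      using True by (auto simp: \<tau>_def int_iterate_def TS)
  next
    case False
    then have "nat (- (k - 1)) = Suc (nat (- k))" by simp
    then show ?thesis
      using False by (cases "k = 0") (auto simp: \<tau>_def int_iterate_def)
  qed
qed

lemma measurable_tau [measurable]: "\<tau> k \<in> measurable M M"
  unfolding \<tau>_def int_iterate_def using measurable_T by (auto intro: measurable_compose_n)

lemma tau_space: "\<omega> \<in> space M \<Longrightarrow> \<tau> k \<omega> \<in> space M"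
  using measurable_space[OF measurable_tau] .

lemma tau_add:
  assumes "\<omega> \<in> space M"
  shows "\<tau> (j + k) \<omega> = \<tau> j (\<tau> k \<omega>)"
proof (induction j rule: int_induct[of _ 0])
  case (step1 i)
  have "\<tau> (i + 1 + k) \<omega> = T (\<tau> (i + k) \<omega>)"
    using tau_step(1)[OF assms, of "i + k"] by (simp add: algebra_simps)
  then show ?case
    using step1 tau_step(1)[OF tau_space[OF assms]] by simp
next
  case (step2 i)
  have "\<tau> (i - 1 + k) \<omega> = inv_into (space M) T (\<tau> (i + k) \<omega>)"
    using tau_step(2)[OF assms, of "i + k"] by (simp add: algebra_simps)
  then show ?case
    using step2 tau_step(2)[OF tau_space[OF assms]] by simp
qed (simp add: tau_zero)

lemma distr_tau: "distr M M (\<tau> k) = M"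
proof -
  have "distr M M (f ^^ n) = M" if f: "distr M M f = M" "f \<in> measurable M M" for f n
  proof (induction n)
    case 0
    then show ?case by (simp add: id_def)
  next
    case (Suc n)
    have "distr M M (f \<circ> (f ^^ n)) = distr (distr M M (f ^^ n)) M f"
      using f(2) by (intro distr_distr[symmetric] measurable_compose_n) auto
    then show ?case using Suc f(1) by (simp add: comp_def)
  qed
  then show ?thesis
    unfolding \<tau>_def int_iterate_def using distr_T measurable_T by simp
qed

lemma integral_tau:
  fixes h :: "'a \<Rightarrow> real"
  assumes "h \<in> borel_measurable M"
  shows "(\<integral>\<omega>. h (\<tau> k \<omega>) \<partial>M) = (\<integral>\<omega>. h \<omega> \<partial>M)"
  using integral_distr[OF measurable_tau assms, of k] by (simp add: distr_tau)

lemma nn_integral_tau: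
  assumes "h \<in> borel_measurable M"
  shows "(\<integral>\<^sup>+\<omega>. h (\<tau> k \<omega>) \<partial>M) = (\<integral>\<^sup>+\<omega>. h \<omega> \<partial>M)"
  using nn_integral_distr[OF measurable_tau, of h k] assms by (simp add: distr_tau)

lemma integrable_tau:
  fixes h :: "'a \<Rightarrow> real"
  assumes "integrable M h"
  shows "integrable M (\<lambda>\<omega>. h (\<tau> k \<omega>))"
  using integrable_distr[OF measurable_tau, of k h] assms by (simp add: distr_tau)

lemma measure_tau:
  assumes "A \<in> sets M"
  shows "measure M (\<tau> k -` A \<inter> space M) = measure M A"
  using measure_distr[OF measurable_tau assms, of k] by (simp add: distr_tau)

section \<open>The square function\<close>

text \<open>The series is integrated termwise; each term has integral \<open>c k * (\<integral>p)\<close> by invariance. This gives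
  at once the convergence almost everywhere of all the orbit series below.\<close>
lemma orbit_sum:
  fixes c :: "int \<Rightarrow> real" and p :: "'a \<Rightarrow> real"
  assumes c: "c summable_on UNIV" "\<And>k. 0 \<le> c k" and p: "integrable M p" "\<And>\<omega>. 0 \<le> p \<omega>"
  shows "AE \<omega> in M. (\<lambda>k. c k * p (\<tau> k \<omega>)) summable_on UNIV"
    and "integrable M (\<lambda>\<omega>. \<Sum>\<^sub>\<infinity>k. c k * p (\<tau> k \<omega>))"
    and "(\<integral>\<omega>. (\<Sum>\<^sub>\<infinity>k. c k * p (\<tau> k \<omega>)) \<partial>M) \<le> (\<Sum>\<^sub>\<infinity>k. c k) * (\<integral>\<omega>. p \<omega> \<partial>M)"
proof -
  have [measurable]: "p \<in> borel_measurable M"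
    using p by auto
  define b where "b n \<omega> = c (int_decode n) * p (\<tau> (int_decode n) \<omega>)" for n \<omega>
  define C where "C = (\<Sum>\<^sub>\<infinity>k. c k)"
  define I where "I = (\<integral>\<omega>. p \<omega> \<partial>M)"
  have [measurable]: "b n \<in> borel_measurable M" for n
    unfolding b_def by measurable
  have b_nonneg: "0 \<le> b n \<omega>" for n \<omega>
    using c p by (simp add: b_def)
  have sums_c: "(\<lambda>n. c (int_decode n)) sums C"
    using c infsum_int_eq_suminf[of c] by (simp add: C_def suminf_ennreal2 suminf_nonneg summable_sums)
  have C: "0 \<le> C" unfolding C_def using c by (simp add: infsum_nonneg)
  have I: "0 \<le> I" unfolding I_def using p by (simp add: integral_nonneg_AE)
  have nn: "(\<integral>\<^sup>+\<omega>. (\<Sum>n. ennreal (b n \<omega>)) \<partial>M) = ennreal (C * I)"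
  proof -
    have "(\<integral>\<^sup>+\<omega>. (\<Sum>n. ennreal (b n \<omega>)) \<partial>M) = (\<Sum>n. \<integral>\<^sup>+\<omega>. ennreal (b n \<omega>) \<partial>M)"
      by (rule nn_integral_suminf) measurable
    also have "\<dots> = (\<Sum>n. ennreal (c (int_decode n) * I))"
    proof (intro arg_cong[where f = suminf] ext)
      fix n
      have "(\<integral>\<^sup>+\<omega>. ennreal (b n \<omega>) \<partial>M) = ennreal (c (int_decode n)) * (\<integral>\<^sup>+\<omega>. ennreal (p (\<tau> (int_decode n) \<omega>)) \<partial>M)"
        using c p by (simp add: b_def ennreal_mult nn_integral_cmult)
      also have "(\<integral>\<^sup>+\<omega>. ennreal (p (\<tau> (int_decode n) \<omega>)) \<partial>M) = ennreal I"
        using p by (subst nn_integral_tau[of "\<lambda>x. ennreal (p x)"]) (auto simp: nn_integral_eq_integral I_def)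
      finally show "(\<integral>\<^sup>+\<omega>. ennreal (b n \<omega>) \<partial>M) = ennreal (c (int_decode n) * I)"
        using c by (simp add: ennreal_mult I)
    qed
    also have "(\<Sum>n. ennreal (c (int_decode n) * I)) = ennreal (C * I)"
      using c I by (intro suminf_ennreal_eq sums_mult2 sums_c) auto
    finally show ?thesis .
  qed
  have "AE \<omega> in M. (\<Sum>n. ennreal (b n \<omega>)) \<noteq> \<infinity>"
    using nn by (intro nn_integral_noteq_infinite) auto
  then have summ: "AE \<omega> in M. summable (\<lambda>n. b n \<omega>)"
    by eventually_elim (auto intro: summable_suminf_not_top b_nonneg)
  have summable_iff: "(\<lambda>k. c k * p (\<tau> k \<omega>)) summable_on UNIV \<longleftrightarrow> summable (\<lambda>n. b n \<omega>)" for \<omega>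
    unfolding b_def using c p by (intro infsum_int_eq_suminf) auto
  show "AE \<omega> in M. (\<lambda>k. c k * p (\<tau> k \<omega>)) summable_on UNIV"
    unfolding summable_iff by (rule summ)
  have sum_eq: "ennreal (\<Sum>\<^sub>\<infinity>k. c k * p (\<tau> k \<omega>)) = (\<Sum>n. ennreal (b n \<omega>))"
    if "summable (\<lambda>n. b n \<omega>)" for \<omega>
    using that c p infsum_int_eq_suminf(2)[of "\<lambda>k. c k * p (\<tau> k \<omega>)"]
    by (simp add: b_def[symmetric] b_nonneg suminf_ennreal2 suminf_nonneg)
  have nonneg: "0 \<le> (\<Sum>\<^sub>\<infinity>k. c k * p (\<tau> k \<omega>))" for \<omega>
    using c p by (simp add: infsum_nonneg)
  have [measurable]: "(\<lambda>\<omega>. \<Sum>\<^sub>\<infinity>k. c k * p (\<tau> k \<omega>)) \<in> borel_measurable M"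
    using c p by (intro borel_measurable_infsum_int) auto
  have nn': "(\<integral>\<^sup>+\<omega>. ennreal (\<Sum>\<^sub>\<infinity>k. c k * p (\<tau> k \<omega>)) \<partial>M) = ennreal (C * I)"
    unfolding nn[symmetric] using summ by (intro nn_integral_cong_AE) (auto simp: sum_eq)
  show int: "integrable M (\<lambda>\<omega>. \<Sum>\<^sub>\<infinity>k. c k * p (\<tau> k \<omega>))"
    using nn' nonneg by (intro integrableI_nonneg) auto
  have "(\<integral>\<omega>. (\<Sum>\<^sub>\<infinity>k. c k * p (\<tau> k \<omega>)) \<partial>M) = C * I"
    using nn' nonneg C I by (intro integral_eq_nn_integral[THEN trans]) auto
  then show "(\<integral>\<omega>. (\<Sum>\<^sub>\<infinity>k. c k * p (\<tau> k \<omega>)) \<partial>M) \<le> (\<Sum>\<^sub>\<infinity>k. c k) * (\<integral>\<omega>. p \<omega> \<partial>M)"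
    by (simp add: C_def I_def)
qed

definition square_fun :: "('a \<Rightarrow> real) \<Rightarrow> 'a \<Rightarrow> real" where
  "square_fun p \<omega> = sqrt (\<Sum>\<^sub>\<infinity>k. a k * (p (\<tau> k \<omega>))\<^sup>2)"

definition renorm :: "('a \<Rightarrow> real) \<Rightarrow> real" where
  "renorm p = (\<integral>\<omega>. square_fun p \<omega> \<partial>M)"

lemma L1_renorm_eq: "L1_renorm M T a f = renorm (\<lambda>\<omega>. norm (f \<omega>))"
  by (simp add: L1_renorm_def renorm_def square_fun_def \<tau>_def)

lemma square_fun_nonneg: "0 \<le> square_fun p \<omega>"
  unfolding square_fun_def using a_nonneg by (simp add: infsum_nonneg)

lemma renorm_nonneg: "0 \<le> renorm p"
  unfolding renorm_def by (simp add: integral_nonneg_AE square_fun_nonneg)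

lemma measurable_square_fun [measurable]:
  assumes [measurable]: "p \<in> borel_measurable M"
  shows "square_fun p \<in> borel_measurable M"
proof -
  have [measurable]: "(\<lambda>\<omega>. \<Sum>\<^sub>\<infinity>k. a k * (p (\<tau> k \<omega>))\<^sup>2) \<in> borel_measurable M"
    using a_nonneg by (intro borel_measurable_infsum_int) auto
  show ?thesis
    unfolding square_fun_def[abs_def] by measurable
qed

lemma AE_summable_squares:
  assumes p: "integrable M p" "\<And>\<omega>. 0 \<le> p \<omega>"
  shows "AE \<omega> in M. (\<lambda>k. a k * (p (\<tau> k \<omega>))\<^sup>2) summable_on UNIV"
proof -
  have "AE \<omega> in M. (\<lambda>k. sqrt (a k) * p (\<tau> k \<omega>)) summable_on UNIV"
    using summable_sqrt a_nonneg p by (intro orbit_sum) auto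
  then show ?thesis
  proof eventually_elim
    case (elim \<omega>)
    show ?case
      using square_summable_nonneg(1)[OF elim] a_nonneg p by (simp add: power_mult_distrib)
  qed
qed

text \<open>For \<open>k \<in> K\<close> the factor \<open>v \<circ> \<tau> k\<close> is replaced by its majorant \<open>v'\<close>; for the other \<open>k\<close> the
  \<open>\<ell>\<^sub>2\<close> norm is replaced by the larger \<open>\<ell>\<^sub>1\<close> norm, whose integral is controlled by invariance.\<close>
lemma square_fun_mult_le:
  fixes p v v' :: "'a \<Rightarrow> real" and K :: "int set"
  assumes p: "integrable M p" "\<And>\<omega>. 0 \<le> p \<omega>"
    and vp: "integrable M (\<lambda>\<omega>. v \<omega> * p \<omega>)"
    and v: "\<And>\<omega>. 0 \<le> v \<omega>"
    and v': "\<And>\<omega> k. \<omega> \<in> space M \<Longrightarrow> k \<in> K \<Longrightarrow> v (\<tau> k \<omega>) \<le> v' \<omega>" "\<And>\<omega>. 0 \<le> v' \<omega>"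
  shows "AE \<omega> in M. square_fun (\<lambda>\<omega>. v \<omega> * p \<omega>) \<omega> \<le>
    v' \<omega> * square_fun p \<omega> +
    (\<Sum>\<^sub>\<infinity>k. (if k \<in> K then 0 else sqrt (a k)) * (v (\<tau> k \<omega>) * p (\<tau> k \<omega>)))"
proof -
  let ?c = "\<lambda>k. if k \<in> K then 0 else sqrt (a k)"
  let ?q = "\<lambda>\<omega>. v \<omega> * p \<omega>"
  have c: "?c summable_on UNIV"
    by (rule summable_on_comparison_test[OF summable_sqrt]) (auto simp: a_nonneg)
  have "AE \<omega> in M. (\<lambda>k. ?c k * ?q (\<tau> k \<omega>)) summable_on UNIV"
    using c a_nonneg p v vp by (intro orbit_sum) auto
  moreover have "AE \<omega> in M. (\<lambda>k. a k * (p (\<tau> k \<omega>))\<^sup>2) summable_on UNIV"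
    using p by (rule AE_summable_squares)
  moreover have "AE \<omega> in M. (\<lambda>k. a k * (?q (\<tau> k \<omega>))\<^sup>2) summable_on UNIV"
    using vp p v by (intro AE_summable_squares) auto
  moreover have "AE \<omega> in M. \<omega> \<in> space M" by simp
  ultimately show ?thesis
  proof eventually_elim
    case (elim \<omega>)
    let ?y = "\<lambda>k. ?c k * ?q (\<tau> k \<omega>)"
    let ?x = "\<lambda>k. a k * (p (\<tau> k \<omega>))\<^sup>2"
    have y: "0 \<le> ?y k" for k
      using a_nonneg p v by auto
    have le: "a k * (?q (\<tau> k \<omega>))\<^sup>2 \<le> (v' \<omega>)\<^sup>2 * ?x k + (?y k)\<^sup>2" for k
    proof (cases "k \<in> K")
      case True
      then have "(v (\<tau> k \<omega>))\<^sup>2 \<le> (v' \<omega>)\<^sup>2"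
        using v v' elim by (intro power_mono) auto
      then have "(v (\<tau> k \<omega>))\<^sup>2 * ?x k \<le> (v' \<omega>)\<^sup>2 * ?x k"
        using a_nonneg by (intro mult_right_mono) auto
      then show ?thesis using True by (simp add: power_mult_distrib algebra_simps)
    next
      case False
      then show ?thesis
        using a_nonneg by (simp add: power_mult_distrib)
    qed
    have "(\<Sum>\<^sub>\<infinity>k. a k * (?q (\<tau> k \<omega>))\<^sup>2) \<le> (\<Sum>\<^sub>\<infinity>k. (v' \<omega>)\<^sup>2 * ?x k + (?y k)\<^sup>2)"
      using elim le y by (intro infsum_mono summable_on_add summable_on_cmult_right square_summable_nonneg) auto
    also have "\<dots> = (v' \<omega>)\<^sup>2 * (\<Sum>\<^sub>\<infinity>k. ?x k) + (\<Sum>\<^sub>\<infinity>k. (?y k)\<^sup>2)"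
      using elim y
      by (subst infsum_add) (auto intro!: infsum_cmult_right' summable_on_cmult_right square_summable_nonneg)
    also have "\<dots> \<le> (v' \<omega>)\<^sup>2 * (\<Sum>\<^sub>\<infinity>k. ?x k) + (\<Sum>\<^sub>\<infinity>k. ?y k)\<^sup>2"
      using elim y by (intro add_left_mono square_summable_nonneg) auto
    finally have "square_fun ?q \<omega> \<le> sqrt ((v' \<omega>)\<^sup>2 * (\<Sum>\<^sub>\<infinity>k. ?x k) + (\<Sum>\<^sub>\<infinity>k. ?y k)\<^sup>2)"
      unfolding square_fun_def by (rule real_sqrt_le_mono)
    also have "\<dots> \<le> sqrt ((v' \<omega>)\<^sup>2 * (\<Sum>\<^sub>\<infinity>k. ?x k)) + sqrt ((\<Sum>\<^sub>\<infinity>k. ?y k)\<^sup>2)"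
      using a_nonneg by (intro sqrt_add_le_add_sqrt mult_nonneg_nonneg infsum_nonneg) auto
    also have "\<dots> = v' \<omega> * square_fun p \<omega> + (\<Sum>\<^sub>\<infinity>k. ?y k)"
      using v' y by (simp add: real_sqrt_mult square_fun_def infsum_nonneg)
    finally show ?case .
  qed
qed

text \<open>With \<open>K = {}\<close> this is the full sum of the \<open>sqrt (a k)\<close>, the constant that bounds the renorming by
  the \<open>L\<^sub>1\<close> norm.\<close>
definition tail :: "int set \<Rightarrow> real" where
  "tail K = (\<Sum>\<^sub>\<infinity>k. if k \<in> K then 0 else sqrt (a k))"

lemma tail_nonneg: "0 \<le> tail K"
  unfolding tail_def by (rule infsum_nonneg) (auto simp: a_nonneg)

lemma integrable_square_fun:
  assumes p: "integrable M p" "\<And>\<omega>. 0 \<le> p \<omega>"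
  shows "integrable M (square_fun p)"
proof (rule Bochner_Integration.integrable_bound)
  show "integrable M (\<lambda>\<omega>. \<Sum>\<^sub>\<infinity>k. sqrt (a k) * p (\<tau> k \<omega>))"
    using summable_sqrt a_nonneg p by (intro orbit_sum) auto
  show "square_fun p \<in> borel_measurable M"
    using p by measurable
  have "AE \<omega> in M. square_fun p \<omega> \<le> (\<Sum>\<^sub>\<infinity>k. sqrt (a k) * p (\<tau> k \<omega>))"
    using square_fun_mult_le[OF p, of "\<lambda>_. 1" "{}" "\<lambda>_. 0"] p by simp
  then show "AE \<omega> in M. norm (square_fun p \<omega>) \<le> norm (\<Sum>\<^sub>\<infinity>k. sqrt (a k) * p (\<tau> k \<omega>))"
    by eventually_elim (use square_fun_nonneg in auto)
qed

text \<open>The basic estimate. If \<open>v\<close> varies slowly along orbits then \<open>v'\<close> can be taken close to \<open>v\<close>, and up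
  to a small tail the renorming of \<open>v p\<close> is at most the integral of \<open>S p\<close> with weight \<open>v\<close>,
  which is additive in \<open>v\<close>.\<close>
lemma renorm_mult_le:
  fixes p v v' :: "'a \<Rightarrow> real" and K :: "int set"
  assumes p: "integrable M p" "\<And>\<omega>. 0 \<le> p \<omega>"
    and vp: "integrable M (\<lambda>\<omega>. v \<omega> * p \<omega>)"
    and v: "\<And>\<omega>. 0 \<le> v \<omega>"
    and v': "\<And>\<omega> k. \<omega> \<in> space M \<Longrightarrow> k \<in> K \<Longrightarrow> v (\<tau> k \<omega>) \<le> v' \<omega>" "\<And>\<omega>. 0 \<le> v' \<omega>"
      "integrable M (\<lambda>\<omega>. v' \<omega> * square_fun p \<omega>)"
  shows "renorm (\<lambda>\<omega>. v \<omega> * p \<omega>) \<le>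
    (\<integral>\<omega>. v' \<omega> * square_fun p \<omega> \<partial>M) + tail K * (\<integral>\<omega>. v \<omega> * p \<omega> \<partial>M)"
proof -
  let ?c = "\<lambda>k. if k \<in> K then 0 else sqrt (a k)"
  let ?q = "\<lambda>\<omega>. v \<omega> * p \<omega>"
  have c: "?c summable_on UNIV"
    by (rule summable_on_comparison_test[OF summable_sqrt]) (auto simp: a_nonneg)
  have os: "integrable M (\<lambda>\<omega>. \<Sum>\<^sub>\<infinity>k. ?c k * ?q (\<tau> k \<omega>))"
    "(\<integral>\<omega>. (\<Sum>\<^sub>\<infinity>k. ?c k * ?q (\<tau> k \<omega>)) \<partial>M) \<le> (\<Sum>\<^sub>\<infinity>k. ?c k) * (\<integral>\<omega>. ?q \<omega> \<partial>M)"
    by (rule orbit_sum[OF c _ vp]; use a_nonneg p v in auto)+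
  have "renorm ?q \<le> (\<integral>\<omega>. v' \<omega> * square_fun p \<omega> + (\<Sum>\<^sub>\<infinity>k. ?c k * ?q (\<tau> k \<omega>)) \<partial>M)"
    unfolding renorm_def
    using square_fun_mult_le[OF p vp v v'(1,2)] p v
    by (intro integral_mono_AE integrable_square_fun vp Bochner_Integration.integrable_add os v') auto
  also have "\<dots> = (\<integral>\<omega>. v' \<omega> * square_fun p \<omega> \<partial>M) + (\<integral>\<omega>. (\<Sum>\<^sub>\<infinity>k. ?c k * ?q (\<tau> k \<omega>)) \<partial>M)"
    by (intro Bochner_Integration.integral_add os v')
  also have "\<dots> \<le> (\<integral>\<omega>. v' \<omega> * square_fun p \<omega> \<partial>M) + tail K * (\<integral>\<omega>. ?q \<omega> \<partial>M)"
    unfolding tail_def by (intro add_left_mono os)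
  finally show ?thesis .
qed

text \<open>The term \<open>k = 0\<close> of the square function alone dominates a multiple of \<open>p\<close>.\<close>
lemma integral_le_renorm:
  assumes p: "integrable M p" "\<And>\<omega>. 0 \<le> p \<omega>"
  shows "sqrt (a 0) * (\<integral>\<omega>. p \<omega> \<partial>M) \<le> renorm p"
proof -
  have "AE \<omega> in M. sqrt (a 0) * p \<omega> \<le> square_fun p \<omega>"
    using AE_summable_squares[OF p]
  proof eventually_elim
    case (elim \<omega>)
    have "(\<Sum>k\<in>{0}. a k * (p (\<tau> k \<omega>))\<^sup>2) \<le> (\<Sum>\<^sub>\<infinity>k. a k * (p (\<tau> k \<omega>))\<^sup>2)"
      using elim a_nonneg by (intro finite_sum_le_infsum) auto
    then have "sqrt (a 0 * (p \<omega>)\<^sup>2) \<le> square_fun p \<omega>"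
      by (simp add: square_fun_def tau_zero)
    then show ?case
      using p by (simp add: real_sqrt_mult)
  qed
  then have "(\<integral>\<omega>. sqrt (a 0) * p \<omega> \<partial>M) \<le> renorm p"
    unfolding renorm_def using p by (intro integral_mono_AE integrable_square_fun) auto
  then show ?thesis by simp
qed

lemma renorm_le_integral:
  assumes p: "integrable M p" "\<And>\<omega>. 0 \<le> p \<omega>"
  shows "renorm p \<le> tail {} * (\<integral>\<omega>. p \<omega> \<partial>M)"
  using renorm_mult_le[OF p, of "\<lambda>_. 1" "{}" "\<lambda>_. 0"] p by simp

lemma renorm_cmult:
  assumes "0 \<le> c"
  shows "renorm (\<lambda>\<omega>. c * p \<omega>) = c * renorm p"
proof -
  have "square_fun (\<lambda>\<omega>. c * p \<omega>) \<omega> = c * square_fun p \<omega>" for \<omega>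
  proof -
    have "(\<Sum>\<^sub>\<infinity>k. a k * (c * p (\<tau> k \<omega>))\<^sup>2) = c\<^sup>2 * (\<Sum>\<^sub>\<infinity>k. a k * (p (\<tau> k \<omega>))\<^sup>2)"
      by (subst infsum_cmult_right'[symmetric]) (simp add: power_mult_distrib algebra_simps)
    then show ?thesis
      using assms by (simp add: square_fun_def real_sqrt_mult)
  qed
  then show ?thesis by (simp add: renorm_def)
qed

lemma small_tail:
  assumes "0 < e"
  obtains N :: nat where "tail {- int N..int N} < e"
proof -
  have S: "(\<lambda>k. sqrt (a k)) summable_on UNIV" by (rule summable_sqrt)
  let ?S = "\<Sum>\<^sub>\<infinity>k. sqrt (a k)"
  have "((\<lambda>k. sqrt (a k)) has_sum ?S) UNIV"
    using S by (rule has_sum_infsum)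
  then have "eventually (\<lambda>F. sum (\<lambda>k. sqrt (a k)) F > ?S - e) (finite_subsets_at_top UNIV)"
    unfolding has_sum_def using assms by (intro order_tendstoD) auto
  then obtain F where F: "finite F" "\<And>G. finite G \<Longrightarrow> F \<subseteq> G \<Longrightarrow> sum (\<lambda>k. sqrt (a k)) G > ?S - e"
    unfolding eventually_finite_subsets_at_top by auto
  obtain N :: nat where N: "\<And>k. k \<in> F \<Longrightarrow> nat \<bar>k\<bar> \<le> N"
    using finite_nat_set_iff_bounded_le[of "(\<lambda>k. nat \<bar>k\<bar>) ` F"] F(1) by auto
  let ?K = "{- int N..int N}"
  have "F \<subseteq> ?K" using N by force
  then have "sum (\<lambda>k. sqrt (a k)) ?K > ?S - e"
    by (intro F) auto
  moreover have "?S = infsum (\<lambda>k. sqrt (a k)) ?K + infsum (\<lambda>k. sqrt (a k)) (- ?K)"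
  proof -
    have "infsum (\<lambda>k. sqrt (a k)) (?K \<union> - ?K) = infsum (\<lambda>k. sqrt (a k)) ?K + infsum (\<lambda>k. sqrt (a k)) (- ?K)"
      by (rule infsum_Un_disjoint) (auto intro: summable_on_subset_banach[OF S])
    then show ?thesis by (simp only: Un_UNIV_left Compl_partition)
  qed
  moreover have "tail ?K = infsum (\<lambda>k. sqrt (a k)) (- ?K)"
    unfolding tail_def by (rule infsum_cong_neutral) auto
  ultimately have "tail ?K < e" by simp
  then show ?thesis by (rule that)
qed

section \<open>The dual norm\<close>

lemma ess_boundedD:
  assumes "\<Phi> \<in> ess_bounded M"
  shows "\<Phi> \<in> borel_measurable M" and "\<exists>C\<ge>0. AE \<omega> in M. norm (\<Phi> \<omega>) \<le> C"
proof -
  show "\<Phi> \<in> borel_measurable M"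
    using assms by (simp add: ess_bounded_def)
  obtain C where "AE \<omega> in M. norm (\<Phi> \<omega>) \<le> C"
    using assms by (auto simp: ess_bounded_def)
  then have "AE \<omega> in M. norm (\<Phi> \<omega>) \<le> max C 0" by eventually_elim auto
  then show "\<exists>C\<ge>0. AE \<omega> in M. norm (\<Phi> \<omega>) \<le> C"
    by (intro exI[of _ "max C 0"]) auto
qed

lemma ess_bounded_zero: "(\<lambda>_. 0) \<in> ess_bounded M"
  by (auto simp: ess_bounded_def)

lemma ess_bounded_add:
  fixes \<Phi> \<Psi> :: "'a \<Rightarrow> 'k::{real_normed_field, second_countable_topology}"
  assumes "\<Phi> \<in> ess_bounded M" "\<Psi> \<in> ess_bounded M"
  shows "(\<lambda>\<omega>. \<Phi> \<omega> + \<Psi> \<omega>) \<in> ess_bounded M"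
proof -
  obtain C D where "AE \<omega> in M. norm (\<Phi> \<omega>) \<le> C" "AE \<omega> in M. norm (\<Psi> \<omega>) \<le> D"
    using assms by (auto simp: ess_bounded_def)
  then have "AE \<omega> in M. norm (\<Phi> \<omega> + \<Psi> \<omega>) \<le> C + D"
    by eventually_elim (rule norm_triangle_mono)
  then show ?thesis
    using assms by (auto simp: ess_bounded_def)
qed

lemma ess_bounded_mult:
  fixes \<Phi> \<Psi> :: "'a \<Rightarrow> 'k::{real_normed_field, second_countable_topology}"
  assumes "\<Phi> \<in> ess_bounded M" "\<Psi> \<in> ess_bounded M"
  shows "(\<lambda>\<omega>. \<Phi> \<omega> * \<Psi> \<omega>) \<in> ess_bounded M"
proof -
  obtain C D where *: "AE \<omega> in M. norm (\<Phi> \<omega>) \<le> C" "0 \<le> C" "AE \<omega> in M. norm (\<Psi> \<omega>) \<le> D"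
    using ess_boundedD(2)[OF assms(1)] assms(2) by (auto simp: ess_bounded_def)
  from *(1,3) have "AE \<omega> in M. norm (\<Phi> \<omega> * \<Psi> \<omega>) \<le> C * D"
    by eventually_elim (auto simp: norm_mult intro!: mult_mono *(2))
  then show ?thesis
    using assms by (auto simp: ess_bounded_def)
qed

lemma ess_bounded_const: "(\<lambda>_. c) \<in> ess_bounded M"
  by (auto simp: ess_bounded_def)

lemma ess_bounded_of_real:
  assumes "u \<in> borel_measurable M" "\<And>\<omega>. \<bar>u \<omega>\<bar> \<le> 1"
  shows "(\<lambda>\<omega>. of_real (u \<omega>) :: 'k::{real_normed_field, second_countable_topology}) \<in> ess_bounded M"
  using assms by (auto simp: ess_bounded_def intro!: exI[of _ 1])

lemma ess_bounded_sum:
  fixes \<Phi> :: "'i \<Rightarrow> 'a \<Rightarrow> 'k::{real_normed_field, second_countable_topology}"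
  assumes "\<And>i. i \<in> I \<Longrightarrow> \<Phi> i \<in> ess_bounded M"
  shows "(\<lambda>\<omega>. \<Sum>i\<in>I. \<Phi> i \<omega>) \<in> ess_bounded M"
  using assms by (induction I rule: infinite_finite_induct)
    (auto intro: ess_bounded_zero ess_bounded_add)

lemma integrable_ess_bounded_mult:
  fixes \<Phi> :: "'a \<Rightarrow> 'k::{real_normed_field, second_countable_topology}"
  assumes "\<Phi> \<in> ess_bounded M" "integrable M p"
  shows "integrable M (\<lambda>\<omega>. norm (\<Phi> \<omega>) * p \<omega> :: real)"
proof -
  obtain C where C: "AE \<omega> in M. norm (\<Phi> \<omega>) \<le> C" "0 \<le> C"
    using ess_boundedD(2)[OF assms(1)] by auto
  have [measurable]: "\<Phi> \<in> borel_measurable M" "p \<in> borel_measurable M"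
    using assms ess_boundedD by auto
  show ?thesis
  proof (rule Bochner_Integration.integrable_bound)
    show "integrable M (\<lambda>\<omega>. C * p \<omega>)" using assms by simp
    show "AE \<omega> in M. norm (norm (\<Phi> \<omega>) * p \<omega>) \<le> norm (C * p \<omega>)"
      using C(1) by eventually_elim (auto simp: abs_mult C(2) intro!: mult_right_mono)
  qed measurable
qed

lemma integral_ess_bounded_le:
  fixes \<Phi> :: "'a \<Rightarrow> 'k::{real_normed_field, second_countable_topology}"
  assumes "\<Phi> \<in> ess_bounded M" "AE \<omega> in M. norm (\<Phi> \<omega>) \<le> C" "0 \<le> C"
    and p: "integrable M p" "\<And>\<omega>. 0 \<le> p \<omega>"
  shows "(\<integral>\<omega>. norm (\<Phi> \<omega>) * p \<omega> \<partial>M) \<le> C / sqrt (a 0) * renorm p"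
proof -
  have "(\<integral>\<omega>. norm (\<Phi> \<omega>) * p \<omega> \<partial>M) \<le> (\<integral>\<omega>. C * p \<omega> \<partial>M)"
    using assms(2) p
    by (intro integral_mono_AE integrable_ess_bounded_mult assms) (auto intro!: mult_right_mono)
  also have "\<dots> = C / sqrt (a 0) * (sqrt (a 0) * (\<integral>\<omega>. p \<omega> \<partial>M))"
    using a_pos[of 0] by simp
  also have "\<dots> \<le> C / sqrt (a 0) * renorm p"
    using assms(3) a_nonneg[of 0] by (intro mult_left_mono integral_le_renorm p) auto
  finally show ?thesis .
qed

lemma renorm_zero: "renorm (\<lambda>_. 0) = 0"
  by (simp add: renorm_def square_fun_def)

text \<open>This lemma and the next describe the dual norm by nonnegative real densities in place of scalar
  valued test functions. All later arguments use only this description, and are therefore the same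
  over the real and the complex field.\<close>
lemma dual_norm_least:
  fixes \<Phi> :: "'a \<Rightarrow> 'k::{real_normed_field, banach, second_countable_topology}"
  assumes "\<And>p. integrable M p \<Longrightarrow> (\<And>\<omega>. 0 \<le> p \<omega>) \<Longrightarrow> renorm p \<le> 1 \<Longrightarrow>
    (\<integral>\<omega>. norm (\<Phi> \<omega>) * p \<omega> \<partial>M) \<le> C"
  shows "dual_norm M T a \<Phi> \<le> C"
  unfolding dual_norm_def
proof (rule cSUP_least)
  show "{f :: 'a \<Rightarrow> 'k. integrable M f \<and> L1_renorm M T a f \<le> 1} \<noteq> {}"
    by (auto simp: L1_renorm_eq renorm_zero intro!: exI[of _ "\<lambda>_. 0"])
  fix f :: "'a \<Rightarrow> 'k" assume f: "f \<in> {f. integrable M f \<and> L1_renorm M T a f \<le> 1}"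
  have "norm (\<integral>\<omega>. \<Phi> \<omega> * f \<omega> \<partial>M) \<le> (\<integral>\<omega>. norm (\<Phi> \<omega> * f \<omega>) \<partial>M)"
    by (rule integral_norm_bound)
  also have "\<dots> = (\<integral>\<omega>. norm (\<Phi> \<omega>) * norm (f \<omega>) \<partial>M)"
    by (simp add: norm_mult)
  also have "\<dots> \<le> C"
    using f by (intro assms) (auto simp: L1_renorm_eq)
  finally show "norm (\<integral>\<omega>. \<Phi> \<omega> * f \<omega> \<partial>M) \<le> C" .
qed

lemma dual_norm_upper:
  fixes \<Phi> :: "'a \<Rightarrow> 'k::{real_normed_field, banach, second_countable_topology}"
  assumes \<Phi>: "\<Phi> \<in> ess_bounded M" and p: "integrable M p" "\<And>\<omega>. 0 \<le> p \<omega>"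
  shows "(\<integral>\<omega>. norm (\<Phi> \<omega>) * p \<omega> \<partial>M) \<le> dual_norm M T a \<Phi> * renorm p"
proof -
  have [measurable]: "\<Phi> \<in> borel_measurable M"
    using \<Phi> by (rule ess_boundedD)
  obtain C where C: "AE \<omega> in M. norm (\<Phi> \<omega>) \<le> C" "0 \<le> C"
    using ess_boundedD(2)[OF \<Phi>] by auto
  have bdd: "bdd_above ((\<lambda>f. norm (\<integral>\<omega>. \<Phi> \<omega> * f \<omega> \<partial>M)) ` {f. integrable M f \<and> L1_renorm M T a f \<le> 1})"
  proof (rule bdd_aboveI2)
    fix f :: "'a \<Rightarrow> 'k" assume f: "f \<in> {f. integrable M f \<and> L1_renorm M T a f \<le> 1}"
    have "norm (\<integral>\<omega>. \<Phi> \<omega> * f \<omega> \<partial>M) \<le> (\<integral>\<omega>. norm (\<Phi> \<omega> * f \<omega>) \<partial>M)"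
      by (rule integral_norm_bound)
    also have "\<dots> = (\<integral>\<omega>. norm (\<Phi> \<omega>) * norm (f \<omega>) \<partial>M)"
      by (simp add: norm_mult)
    also have "\<dots> \<le> C / sqrt (a 0) * renorm (\<lambda>\<omega>. norm (f \<omega>))"
      using f by (intro integral_ess_bounded_le \<Phi> C) auto
    also have "\<dots> \<le> C / sqrt (a 0) * 1"
      using f C a_nonneg by (intro mult_left_mono) (auto simp: L1_renorm_eq)
    finally show "norm (\<integral>\<omega>. \<Phi> \<omega> * f \<omega> \<partial>M) \<le> C / sqrt (a 0) * 1" .
  qed
  \<comment> \<open>Multiplying the density by the conjugate phase of \<open>\<Phi>\<close> leaves its renorming unchanged.\<close>
  have unit: "(\<integral>\<omega>. norm (\<Phi> \<omega>) * q \<omega> \<partial>M) \<le> dual_norm M T a \<Phi>"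
    if q: "integrable M q" "\<And>\<omega>. 0 \<le> q \<omega>" "renorm q \<le> 1" for q
  proof -
    have [measurable]: "q \<in> borel_measurable M" using q by auto
    let ?f = "\<lambda>\<omega>. of_real (q \<omega>) * conj_phase (\<Phi> \<omega>) :: 'k"
    have norm_f: "norm (?f \<omega>) = q \<omega>" for \<omega>
      using q by (simp add: norm_mult)
    have int: "integrable M ?f"
      by (rule Bochner_Integration.integrable_bound[OF q(1)]) (use norm_f q in auto)
    have eq: "\<Phi> \<omega> * ?f \<omega> = of_real (norm (\<Phi> \<omega>) * q \<omega>)" for \<omega>
      using conj_phase_mult[of "\<Phi> \<omega>"] by (simp add: algebra_simps)
    have "norm (\<integral>\<omega>. \<Phi> \<omega> * ?f \<omega> \<partial>M) \<le> dual_norm M T a \<Phi>"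
      unfolding dual_norm_def using q int norm_f
      by (intro cSUP_upper[OF _ bdd]) (auto simp: L1_renorm_eq)
    moreover have "norm (\<integral>\<omega>. \<Phi> \<omega> * ?f \<omega> \<partial>M) = \<bar>\<integral>\<omega>. norm (\<Phi> \<omega>) * q \<omega> \<partial>M\<bar>"
      unfolding eq using integrable_ess_bounded_mult[OF \<Phi> q(1)]
      by (subst integral_bounded_linear[OF bounded_linear_of_real]) auto
    ultimately show ?thesis by linarith
  qed
  show ?thesis
  proof (cases "renorm p = 0")
    case True
    then show ?thesis
      using integral_ess_bounded_le[OF \<Phi> C p] by simp
  next
    case False
    then have pos: "0 < renorm p" using renorm_nonneg[of p] by simp
    have "renorm (\<lambda>\<omega>. 1 / renorm p * p \<omega>) \<le> 1"
      using pos by (subst renorm_cmult) auto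
    then have "(\<integral>\<omega>. norm (\<Phi> \<omega>) * (1 / renorm p * p \<omega>) \<partial>M) \<le> dual_norm M T a \<Phi>"
      using pos p by (intro unit) auto
    then have "1 / renorm p * (\<integral>\<omega>. norm (\<Phi> \<omega>) * p \<omega> \<partial>M) \<le> dual_norm M T a \<Phi>"
      by (simp add: mult.left_commute)
    then show ?thesis using pos by (simp add: field_simps)
  qed
qed

lemma dual_norm_nonneg:
  fixes \<Phi> :: "'a \<Rightarrow> 'k::{real_normed_field, banach, second_countable_topology}"
  assumes "\<Phi> \<in> ess_bounded M"
  shows "0 \<le> dual_norm M T a \<Phi>"
proof -
  have "renorm (\<lambda>_. 1) > 0"
    using less_le_trans[OF real_sqrt_gt_zero[OF a_pos[of 0]], of "renorm (\<lambda>_. 1)"]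
      integral_le_renorm[of "\<lambda>_. 1"] by (simp add: prob_space)
  moreover have "0 \<le> (\<integral>\<omega>. norm (\<Phi> \<omega>) * 1 \<partial>M)"
    by (simp add: integral_nonneg_AE)
  ultimately show ?thesis
    using order_trans[OF _ dual_norm_upper[OF assms, of "\<lambda>_. 1"], of 0]
    by (simp add: zero_le_mult_iff)
qed

lemma dual_norm_mono:
  fixes \<Phi> \<Psi> :: "'a \<Rightarrow> 'k::{real_normed_field, banach, second_countable_topology}"
  assumes "\<Phi> \<in> ess_bounded M" "\<Psi> \<in> ess_bounded M" "AE \<omega> in M. norm (\<Phi> \<omega>) \<le> norm (\<Psi> \<omega>)"
  shows "dual_norm M T a \<Phi> \<le> dual_norm M T a \<Psi>"
proof (rule dual_norm_least)
  fix p assume p: "integrable M p" "\<And>\<omega>. 0 \<le> p \<omega>" "renorm p \<le> 1"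
  have "(\<integral>\<omega>. norm (\<Phi> \<omega>) * p \<omega> \<partial>M) \<le> (\<integral>\<omega>. norm (\<Psi> \<omega>) * p \<omega> \<partial>M)"
    using assms(3) p
    by (intro integral_mono_AE integrable_ess_bounded_mult assms) (auto intro!: mult_right_mono)
  also have "\<dots> \<le> dual_norm M T a \<Psi> * renorm p"
    using p by (intro dual_norm_upper assms) auto
  also have "\<dots> \<le> dual_norm M T a \<Psi>"
    using p assms by (simp add: mult_left_le dual_norm_nonneg)
  finally show "(\<integral>\<omega>. norm (\<Phi> \<omega>) * p \<omega> \<partial>M) \<le> dual_norm M T a \<Psi>" .
qed

lemma dual_norm_add:
  fixes \<Phi> \<Psi> :: "'a \<Rightarrow> 'k::{real_normed_field, banach, second_countable_topology}"
  assumes "\<Phi> \<in> ess_bounded M" "\<Psi> \<in> ess_bounded M"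
  shows "dual_norm M T a (\<lambda>\<omega>. \<Phi> \<omega> + \<Psi> \<omega>) \<le> dual_norm M T a \<Phi> + dual_norm M T a \<Psi>"
proof (rule dual_norm_least)
  fix p assume p: "integrable M p" "\<And>\<omega>. 0 \<le> p \<omega>" "renorm p \<le> 1"
  have "(\<integral>\<omega>. norm (\<Phi> \<omega> + \<Psi> \<omega>) * p \<omega> \<partial>M) \<le> (\<integral>\<omega>. norm (\<Phi> \<omega>) * p \<omega> + norm (\<Psi> \<omega>) * p \<omega> \<partial>M)"
    using p by (intro integral_mono_AE integrable_ess_bounded_mult ess_bounded_add assms
        Bochner_Integration.integrable_add)
      (auto simp: distrib_right[symmetric] intro!: mult_right_mono norm_triangle_ineq)
  also have "\<dots> = (\<integral>\<omega>. norm (\<Phi> \<omega>) * p \<omega> \<partial>M) + (\<integral>\<omega>. norm (\<Psi> \<omega>) * p \<omega> \<partial>M)"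
    using p by (intro Bochner_Integration.integral_add integrable_ess_bounded_mult assms)
  also have "\<dots> \<le> dual_norm M T a \<Phi> * renorm p + dual_norm M T a \<Psi> * renorm p"
    using p by (intro add_mono dual_norm_upper assms) auto
  also have "\<dots> \<le> dual_norm M T a \<Phi> + dual_norm M T a \<Psi>"
    using p assms by (intro add_mono) (auto simp: mult_left_le dual_norm_nonneg)
  finally show "(\<integral>\<omega>. norm (\<Phi> \<omega> + \<Psi> \<omega>) * p \<omega> \<partial>M) \<le> \<dots>" .
qed

lemma dual_norm_cmult:
  fixes \<Phi> :: "'a \<Rightarrow> 'k::{real_normed_field, banach, second_countable_topology}"
  assumes "\<Phi> \<in> ess_bounded M"
  shows "dual_norm M T a (\<lambda>\<omega>. c * \<Phi> \<omega>) = norm c * dual_norm M T a \<Phi>"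
proof -
  have le: "dual_norm M T a (\<lambda>\<omega>. c * \<Psi> \<omega>) \<le> norm c * dual_norm M T a \<Psi>"
    if \<Psi>: "\<Psi> \<in> ess_bounded M" for \<Psi> :: "'a \<Rightarrow> 'k" and c
  proof (rule dual_norm_least)
    fix p assume p: "integrable M p" "\<And>\<omega>. 0 \<le> p \<omega>" "renorm p \<le> 1"
    have "(\<integral>\<omega>. norm (c * \<Psi> \<omega>) * p \<omega> \<partial>M) = norm c * (\<integral>\<omega>. norm (\<Psi> \<omega>) * p \<omega> \<partial>M)"
      by (simp add: norm_mult mult.assoc)
    also have "\<dots> \<le> norm c * (dual_norm M T a \<Psi> * renorm p)"
      using p by (intro mult_left_mono dual_norm_upper \<Psi>) auto
    also have "\<dots> \<le> norm c * dual_norm M T a \<Psi>"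
      using p \<Psi> by (intro mult_left_mono) (auto simp: mult_left_le dual_norm_nonneg)
    finally show "(\<integral>\<omega>. norm (c * \<Psi> \<omega>) * p \<omega> \<partial>M) \<le> norm c * dual_norm M T a \<Psi>" .
  qed
  have c\<Phi>: "(\<lambda>\<omega>. c * \<Phi> \<omega>) \<in> ess_bounded M"
    by (intro ess_bounded_mult ess_bounded_const assms)
  show ?thesis
  proof (cases "c = 0")
    case True
    then show ?thesis
      using le[OF assms, of c] dual_norm_nonneg[OF c\<Phi>] by simp
  next
    case False
    have "dual_norm M T a (\<lambda>\<omega>. inverse c * (c * \<Phi> \<omega>)) \<le> norm (inverse c) * dual_norm M T a (\<lambda>\<omega>. c * \<Phi> \<omega>)"
      by (rule le[OF c\<Phi>])
    then have "dual_norm M T a \<Phi> \<le> inverse (norm c) * dual_norm M T a (\<lambda>\<omega>. c * \<Phi> \<omega>)"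
      using False by (simp add: mult.assoc[symmetric] norm_inverse)
    then have "norm c * dual_norm M T a \<Phi> \<le> dual_norm M T a (\<lambda>\<omega>. c * \<Phi> \<omega>)"
      using False by (simp add: field_simps)
    then show ?thesis
      using le[OF assms, of c] by simp
  qed
qed

lemma dual_norm_cong:
  fixes \<Phi> \<Psi> :: "'a \<Rightarrow> 'k::{real_normed_field, banach, second_countable_topology}"
  assumes "\<Phi> \<in> ess_bounded M" "\<Psi> \<in> ess_bounded M" "AE \<omega> in M. \<Phi> \<omega> = \<Psi> \<omega>"
  shows "dual_norm M T a \<Phi> = dual_norm M T a \<Psi>"
  using assms(3) by (intro antisym dual_norm_mono assms) auto

lemma dual_norm_le_bound:
  fixes \<Phi> :: "'a \<Rightarrow> 'k::{real_normed_field, banach, second_countable_topology}"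
  assumes "\<Phi> \<in> ess_bounded M" "AE \<omega> in M. norm (\<Phi> \<omega>) \<le> C" "0 \<le> C"
  shows "dual_norm M T a \<Phi> \<le> C / sqrt (a 0)"
proof (rule dual_norm_least)
  fix p assume p: "integrable M p" "\<And>\<omega>. 0 \<le> p \<omega>" "renorm p \<le> 1"
  have "(\<integral>\<omega>. norm (\<Phi> \<omega>) * p \<omega> \<partial>M) \<le> C / sqrt (a 0) * renorm p"
    using p by (intro integral_ess_bounded_le assms) auto
  also have "\<dots> \<le> C / sqrt (a 0)"
    using p assms a_nonneg[of 0] by (intro mult_left_le) auto
  finally show "(\<integral>\<omega>. norm (\<Phi> \<omega>) * p \<omega> \<partial>M) \<le> C / sqrt (a 0)" .
qed

text \<open>Test against the indicator of the set where \<open>|\<Phi>|\<close> exceeds the bound: its renorming is at most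
  \<open>tail {}\<close> times its measure, so the set is null.\<close>
lemma AE_norm_le_dual_norm:
  fixes \<Phi> :: "'a \<Rightarrow> 'k::{real_normed_field, banach, second_countable_topology}"
  assumes \<Phi>: "\<Phi> \<in> ess_bounded M"
  shows "AE \<omega> in M. norm (\<Phi> \<omega>) \<le> tail {} * dual_norm M T a \<Phi>"
proof -
  have [measurable]: "\<Phi> \<in> borel_measurable M"
    using \<Phi> by (rule ess_boundedD)
  define c where "c = tail {} * dual_norm M T a \<Phi>"
  define A where "A = {\<omega>\<in>space M. c < norm (\<Phi> \<omega>)}"
  have A [measurable]: "A \<in> sets M" unfolding A_def by measurable
  let ?i = "indicator A :: 'a \<Rightarrow> real"
  have int: "integrable M ?i" by (simp add: emeasure_eq_measure)
  have int\<Phi>: "integrable M (\<lambda>\<omega>. norm (\<Phi> \<omega>) * ?i \<omega>)"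
    by (rule integrable_ess_bounded_mult[OF \<Phi> int])
  have int_d: "integrable M (\<lambda>\<omega>. (norm (\<Phi> \<omega>) - c) * ?i \<omega>)"
    unfolding left_diff_distrib using int int\<Phi> by (intro Bochner_Integration.integrable_diff) auto
  have "(\<integral>\<omega>. norm (\<Phi> \<omega>) * ?i \<omega> \<partial>M) \<le> dual_norm M T a \<Phi> * renorm ?i"
    by (rule dual_norm_upper[OF \<Phi> int]) simp
  also have "\<dots> \<le> dual_norm M T a \<Phi> * (tail {} * (\<integral>\<omega>. ?i \<omega> \<partial>M))"
    using \<Phi> int by (intro mult_left_mono renorm_le_integral dual_norm_nonneg) auto
  also have "\<dots> = (\<integral>\<omega>. c * ?i \<omega> \<partial>M)"
    by (simp add: c_def mult_ac)
  finally have "(\<integral>\<omega>. (norm (\<Phi> \<omega>) - c) * ?i \<omega> \<partial>M) \<le> 0"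
    unfolding left_diff_distrib using int int\<Phi> by (subst Bochner_Integration.integral_diff) auto
  moreover have nonneg: "0 \<le> (norm (\<Phi> \<omega>) - c) * ?i \<omega>" for \<omega>
    by (auto simp: A_def split: split_indicator)
  ultimately have "(\<integral>\<omega>. (norm (\<Phi> \<omega>) - c) * ?i \<omega> \<partial>M) = 0"
    by (intro antisym integral_nonneg_AE) auto
  then have "AE \<omega> in M. (norm (\<Phi> \<omega>) - c) * ?i \<omega> = 0"
    using int_d nonneg by (subst (asm) integral_nonneg_eq_0_iff_AE) auto
  moreover have "AE \<omega> in M. \<omega> \<in> space M" by simp
  ultimately show ?thesis
    unfolding c_def[symmetric]
    by eventually_elim (auto simp: A_def split: split_indicator_asm)
qed

section \<open>Norming densities near small sets\<close>

definition orbit_nbhd :: "nat \<Rightarrow> 'a set \<Rightarrow> 'a set" where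
  "orbit_nbhd n B = (\<Union>j\<in>{- int n..int n}. \<tau> j -` B \<inter> space M)"

lemma orbit_nbhd_iff: "\<omega> \<in> orbit_nbhd n B \<longleftrightarrow> \<omega> \<in> space M \<and> (\<exists>j. \<bar>j\<bar> \<le> int n \<and> \<tau> j \<omega> \<in> B)"
  by (force simp: orbit_nbhd_def)

lemma sets_orbit_nbhd [measurable]: "B \<in> sets M \<Longrightarrow> orbit_nbhd n B \<in> sets M"
  unfolding orbit_nbhd_def by (intro sets.finite_UN) auto

lemma measure_orbit_nbhd_le:
  assumes "B \<in> sets M"
  shows "measure M (orbit_nbhd n B) \<le> (2 * real n + 1) * measure M B"
proof -
  have "measure M (orbit_nbhd n B) \<le> (\<Sum>j\<in>{- int n..int n}. measure M (\<tau> j -` B \<inter> space M))"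
    unfolding orbit_nbhd_def using assms by (intro measure_UNION_le) auto
  also have "\<dots> = (2 * real n + 1) * measure M B"
    using assms by (simp add: measure_tau nat_add_distrib)
  finally show ?thesis .
qed

lemma orbit_nbhd_tau:
  assumes "\<omega> \<in> space M" "\<tau> k \<omega> \<in> orbit_nbhd n B" "\<bar>k\<bar> \<le> int N"
  shows "\<omega> \<in> orbit_nbhd (n + N) B"
proof -
  obtain j where j: "\<bar>j\<bar> \<le> int n" "\<tau> j (\<tau> k \<omega>) \<in> B"
    using assms(2) by (auto simp: orbit_nbhd_iff)
  then have "\<tau> (j + k) \<omega> \<in> B" "\<bar>j + k\<bar> \<le> int (n + N)"
    using assms tau_add by auto
  then show ?thesis
    using assms(1) by (auto simp: orbit_nbhd_iff)
qed

text \<open>Weighting by the number of visits to \<open>B\<close> is the same as averaging \<open>q\<close> along the backward orbit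
  and integrating over \<open>B\<close>. This turns an inequality between weighted integrals into a pointwise
  condition on \<open>B\<close>.\<close>
lemma integral_orbit_indicator:
  fixes q :: "'a \<Rightarrow> real"
  assumes q: "integrable M q" and B [measurable]: "B \<in> sets M" and J: "finite J"
  shows "integrable M (\<lambda>\<omega>. (\<Sum>j\<in>J. indicator B (\<tau> j \<omega>)) * q \<omega>)"
    and "(\<integral>\<omega>. (\<Sum>j\<in>J. indicator B (\<tau> j \<omega>)) * q \<omega> \<partial>M)
       = (\<integral>\<omega>. indicator B \<omega> * (\<Sum>j\<in>J. q (\<tau> (- j) \<omega>)) \<partial>M)"
proof -
  have [measurable]: "q \<in> borel_measurable M" using q by auto
  have int: "integrable M (\<lambda>\<omega>. indicator B (\<tau> j \<omega>) * q \<omega>)" for j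
    by (rule Bochner_Integration.integrable_bound[OF q]) (auto split: split_indicator)
  have int': "integrable M (\<lambda>\<omega>. indicator B \<omega> * q (\<tau> (- j) \<omega>))" for j
    by (rule Bochner_Integration.integrable_bound[OF integrable_tau[OF q, of "- j"]])
      (auto split: split_indicator)
  show "integrable M (\<lambda>\<omega>. (\<Sum>j\<in>J. indicator B (\<tau> j \<omega>)) * q \<omega>)"
    unfolding sum_distrib_right by (intro Bochner_Integration.integrable_sum int)
  have eq: "(\<integral>\<omega>. indicator B (\<tau> j \<omega>) * q \<omega> \<partial>M) = (\<integral>\<omega>. indicator B \<omega> * q (\<tau> (- j) \<omega>) \<partial>M)" for j
  proof -
    have "(\<integral>\<omega>. indicator B \<omega> * q (\<tau> (- j) \<omega>) \<partial>M) = (\<integral>\<omega>. indicator B (\<tau> j \<omega>) * q (\<tau> (- j) (\<tau> j \<omega>)) \<partial>M)"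
      by (subst integral_tau[of "\<lambda>\<omega>. indicator B \<omega> * q (\<tau> (- j) \<omega>)" j, symmetric]) auto
    also have "\<dots> = (\<integral>\<omega>. indicator B (\<tau> j \<omega>) * q \<omega> \<partial>M)"
      by (intro Bochner_Integration.integral_cong) (auto simp: tau_add[symmetric] tau_zero)
    finally show ?thesis by simp
  qed
  show "(\<integral>\<omega>. (\<Sum>j\<in>J. indicator B (\<tau> j \<omega>)) * q \<omega> \<partial>M)
       = (\<integral>\<omega>. indicator B \<omega> * (\<Sum>j\<in>J. q (\<tau> (- j) \<omega>)) \<partial>M)"
    unfolding sum_distrib_right sum_distrib_left
    using int int' by (simp add: Bochner_Integration.integral_sum eq)
qed

text \<open>Let \<open>p\<close> be a density with \<open>\<integral>|\<Psi>|p > c\<close>, and let \<open>w\<close> count the visits to \<open>B\<close> at times in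
  \<open>{0..<n}\<close>. For \<open>|k| \<le> N\<close> the translate \<open>w \<circ> \<tau> k\<close> counts visits in a shifted window, so it is at
  most the number \<open>w'\<close> of visits in the window enlarged by \<open>N\<close> on both sides, and \<open>renorm_mult_le\<close>
  applies. Moving all weights onto \<open>B\<close>, the difference \<open>\<integral>|\<Psi>|wp - c |||wp|||\<close> is at least the
  integral over \<open>B\<close> of a function \<open>D\<close> that does not depend on \<open>B\<close>. Its integral over the whole space
  is of order \<open>n\<close> times the original gain, since the enlargement costs only a bounded number of
  terms. Hence \<open>P = {D > 0}\<close> is not null, and every non-null subset of it can serve as \<open>B\<close>.\<close>
lemma norming_density_near_small_sets:
  fixes \<Psi> :: "'a \<Rightarrow> 'k::{real_normed_field, banach, second_countable_topology}"
  assumes \<Psi>: "\<Psi> \<in> ess_bounded M" and c: "0 \<le> c" "c < dual_norm M T a \<Psi>"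
  obtains n P where "P \<in> sets M" and "0 < measure M P"
    and "\<And>B. B \<in> sets M \<Longrightarrow> B \<subseteq> P \<Longrightarrow> 0 < measure M B \<Longrightarrow>
      \<exists>p. integrable M p \<and> (\<forall>\<omega>. 0 \<le> p \<omega>) \<and> (\<forall>\<omega>\<in>space M - orbit_nbhd n B. p \<omega> = 0) \<and>
          c * renorm p < (\<integral>\<omega>. norm (\<Psi> \<omega>) * p \<omega> \<partial>M)"
proof -
  obtain p where p: "integrable M p" "\<And>\<omega>. 0 \<le> p \<omega>" "renorm p \<le> 1"
    and big: "c < (\<integral>\<omega>. norm (\<Psi> \<omega>) * p \<omega> \<partial>M)"
    using dual_norm_least[of \<Psi> c] c(2) by (meson not_le)
  have [measurable]: "p \<in> borel_measurable M" "\<Psi> \<in> borel_measurable M"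
    using p \<Psi> ess_boundedD by auto
  define h where "h \<omega> = norm (\<Psi> \<omega>) * p \<omega>" for \<omega>
  have h: "integrable M h"
    unfolding h_def by (rule integrable_ess_bounded_mult[OF \<Psi> p(1)])
  define I where "I = (\<integral>\<omega>. p \<omega> \<partial>M)"
  have I: "0 \<le> I" unfolding I_def using p by (simp add: integral_nonneg_AE)
  define x where "x = (\<integral>\<omega>. h \<omega> \<partial>M) - c"
  have x: "0 < x" using big by (simp add: x_def h_def)
  \<comment> \<open>The tail and the enlargement of the window may each cost a third of the gain \<open>x\<close>.\<close>
  have "0 < x / (3 * (c * I + 1))"
    using x c I by (intro divide_pos_pos) (auto intro: add_nonneg_pos)
  then obtain N where N: "tail {- int N..int N} < x / (3 * (c * I + 1))"
    using small_tail by blast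
  define t where "t = tail {- int N..int N}"
  have "t * (3 * (c * I + 1)) < x"
    using N c I by (simp add: t_def pos_less_divide_eq add_nonneg_pos)
  then have t: "3 * (c * (t * I)) < x"
    using tail_nonneg[of "{- int N..int N}"] by (simp add: t_def algebra_simps)
  obtain n :: nat where n: "6 * c * N / x < n"
    using reals_Archimedean2 by blast
  then have n': "6 * c * N < n * x"
    using x by (simp add: field_simps)
  define J where "J = {0..<int n}"
  define J' where "J' = {- int N..<int n + int N}"
  have fin: "finite J" "finite J'" by (auto simp: J_def J'_def)
  let ?s = "square_fun p"
  have s: "integrable M ?s" by (rule integrable_square_fun[OF p(1,2)])
  define D where "D \<omega> = (\<Sum>j\<in>J. h (\<tau> (- j) \<omega>)) -
    c * ((\<Sum>j\<in>J'. ?s (\<tau> (- j) \<omega>)) + t * (\<Sum>j\<in>J. p (\<tau> (- j) \<omega>)))" for \<omega>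
  have int_D: "integrable M D"
    unfolding D_def
    by (intro Bochner_Integration.integrable_diff Bochner_Integration.integrable_add
        integrable_mult_right Bochner_Integration.integrable_sum integrable_tau h s p)
  have ints: "integrable M (\<lambda>\<omega>. q (\<tau> j \<omega>))" "(\<integral>\<omega>. q (\<tau> j \<omega>) \<partial>M) = (\<integral>\<omega>. q \<omega> \<partial>M)"
    if "integrable M q" for q :: "'a \<Rightarrow> real" and j
    using that by (auto intro: integrable_tau integral_tau)
  have "(\<integral>\<omega>. D \<omega> \<partial>M) = n * (c + x) - c * ((n + 2 * N) * renorm p + t * (n * I))"
    unfolding D_def using h s p(1) fin
    by (simp add: ints Bochner_Integration.integral_sum integrable_sum x_def renorm_def I_def J_def J'_def)
  also have "\<dots> > 0"
  proof -
    have "c * (real (n + 2 * N) * renorm p) \<le> c * real (n + 2 * N)"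
      using c p by (intro mult_left_mono mult_left_le) auto
    moreover have "n * (3 * (c * (t * I))) \<le> n * x"
      using t by (intro mult_left_mono) auto
    moreover have "0 < n * x" using n' c by (smt (verit) mult_nonneg_nonneg of_nat_0_le_iff)
    ultimately show ?thesis using n' by (simp add: algebra_simps)
  qed
  finally have D_pos: "0 < (\<integral>\<omega>. D \<omega> \<partial>M)" .
  have [measurable]: "D \<in> borel_measurable M" using int_D by auto
  define P where "P = {\<omega>\<in>space M. 0 < D \<omega>}"
  have P [measurable]: "P \<in> sets M" unfolding P_def by measurable
  have P_pos: "0 < measure M P"
  proof (rule ccontr)
    assume "\<not> 0 < measure M P"
    then have "measure M P = 0" using measure_nonneg[of M P] by linarith
    then have "AE \<omega> in M. \<omega> \<notin> P"
      by (intro AE_not_in) (simp add: null_sets_def emeasure_eq_measure)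
    moreover have "AE \<omega> in M. \<omega> \<in> space M" by simp
    ultimately have "AE \<omega> in M. D \<omega> \<le> 0"
      by eventually_elim (auto simp: P_def)
    then have "(\<integral>\<omega>. D \<omega> \<partial>M) \<le> (\<integral>\<omega>. 0 \<partial>M)"
      by (intro integral_mono_AE int_D) auto
    then show False using D_pos by simp
  qed
  have "\<exists>q. integrable M q \<and> (\<forall>\<omega>. 0 \<le> q \<omega>) \<and> (\<forall>\<omega>\<in>space M - orbit_nbhd n B. q \<omega> = 0) \<and>
          c * renorm q < (\<integral>\<omega>. norm (\<Psi> \<omega>) * q \<omega> \<partial>M)"
    if B [measurable]: "B \<in> sets M" and BP: "B \<subseteq> P" and Bpos: "0 < measure M B" for B
  proof -
    define w where "w \<omega> = (\<Sum>j\<in>J. indicator B (\<tau> j \<omega>) :: real)" for \<omega>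
    define w' where "w' \<omega> = (\<Sum>j\<in>J'. indicator B (\<tau> j \<omega>) :: real)" for \<omega>
    note orbit = integral_orbit_indicator[OF _ B fin(1), folded w_def]
      and orbit' = integral_orbit_indicator[OF _ B fin(2), folded w'_def]
    have w: "0 \<le> w \<omega>" "0 \<le> w' \<omega>" for \<omega>
      by (auto simp: w_def w'_def sum_nonneg)
    have ww': "w (\<tau> k \<omega>) \<le> w' \<omega>" if "\<omega> \<in> space M" "k \<in> {- int N..int N}" for \<omega> k
    proof -
      have "w (\<tau> k \<omega>) = (\<Sum>j\<in>J. indicator B (\<tau> (j + k) \<omega>))"
        using that by (simp add: w_def tau_add)
      also have "\<dots> = (\<Sum>j\<in>(\<lambda>j. j + k) ` J. indicator B (\<tau> j \<omega>))"
        by (subst sum.reindex) (auto simp: inj_on_def)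
      also have "\<dots> \<le> w' \<omega>"
        unfolding w'_def using that by (intro sum_mono2 fin) (auto simp: J_def J'_def)
      finally show ?thesis .
    qed
    let ?q = "\<lambda>\<omega>. w \<omega> * p \<omega>"
    have "0 < (\<integral>\<omega>. indicator B \<omega> * D \<omega> \<partial>M)"
    proof -
      have int: "integrable M (\<lambda>\<omega>. indicator B \<omega> * D \<omega>)"
        by (rule Bochner_Integration.integrable_bound[OF int_D]) (auto split: split_indicator)
      have nonneg: "0 \<le> indicator B \<omega> * D \<omega>" for \<omega>
        using BP by (auto simp: P_def split: split_indicator)
      have "(\<integral>\<omega>. indicator B \<omega> * D \<omega> \<partial>M) \<noteq> 0"
      proof
        assume "(\<integral>\<omega>. indicator B \<omega> * D \<omega> \<partial>M) = 0"
        then have "AE \<omega> in M. indicator B \<omega> * D \<omega> = 0"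
          using int nonneg by (subst (asm) integral_nonneg_eq_0_iff_AE) auto
        then have "AE \<omega> in M. \<omega> \<notin> B"
          by eventually_elim (use BP in \<open>auto simp: P_def split: split_indicator_asm\<close>)
        then have "measure M B = 0"
          using B sets.sets_into_space[OF B] prob_eq_0[of B] by simp
        then show False using Bpos by simp
      qed
      then show ?thesis
        using integral_nonneg_AE[of "\<lambda>\<omega>. indicator B \<omega> * D \<omega>" M] nonneg by (simp add: less_le)
    qed
    also have "(\<integral>\<omega>. indicator B \<omega> * D \<omega> \<partial>M) =
      (\<integral>\<omega>. w \<omega> * h \<omega> \<partial>M) - c * ((\<integral>\<omega>. w' \<omega> * ?s \<omega> \<partial>M) + t * (\<integral>\<omega>. w \<omega> * p \<omega> \<partial>M))"
    proof -
      have int: "integrable M (\<lambda>\<omega>. indicator B \<omega> * (\<Sum>j\<in>K. q (\<tau> (- j) \<omega>)))"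
        if "integrable M q" for q :: "'a \<Rightarrow> real" and K
      proof (rule Bochner_Integration.integrable_bound)
        show "integrable M (\<lambda>\<omega>. \<Sum>j\<in>K. q (\<tau> (- j) \<omega>))"
          using that by (simp add: ints)
        have [measurable]: "q \<in> borel_measurable M" using that by auto
        show "(\<lambda>\<omega>. indicator B \<omega> * (\<Sum>j\<in>K. q (\<tau> (- j) \<omega>))) \<in> borel_measurable M" by measurable
      qed (auto split: split_indicator)
      have split: "indicator B \<omega> * D \<omega> = indicator B \<omega> * (\<Sum>j\<in>J. h (\<tau> (- j) \<omega>)) -
        c * (indicator B \<omega> * (\<Sum>j\<in>J'. ?s (\<tau> (- j) \<omega>)) + t * (indicator B \<omega> * (\<Sum>j\<in>J. p (\<tau> (- j) \<omega>))))" for \<omega>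
        by (simp add: D_def algebra_simps)
      show ?thesis
        unfolding split orbit(2)[OF h] orbit(2)[OF p(1)] orbit'(2)[OF s]
        using int[OF h] int[OF s] int[OF p(1)] by simp
    qed
    also have "\<dots> \<le> (\<integral>\<omega>. w \<omega> * h \<omega> \<partial>M) - c * renorm ?q"
      unfolding t_def
      using c by (intro diff_left_mono mult_left_mono renorm_mult_le p orbit orbit' s w ww') auto
    finally have "c * renorm ?q < (\<integral>\<omega>. norm (\<Psi> \<omega>) * ?q \<omega> \<partial>M)"
      by (simp add: h_def mult_ac)
    moreover have "?q \<omega> = 0" if "\<omega> \<in> space M - orbit_nbhd n B" for \<omega>
    proof -
      have "indicator B (\<tau> j \<omega>) = (0::real)" if "j \<in> J" for j
      proof -
        have "\<bar>j\<bar> \<le> int n" using that by (auto simp: J_def)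
        then show ?thesis
          using \<open>\<omega> \<in> space M - orbit_nbhd n B\<close> by (auto simp: orbit_nbhd_iff)
      qed
      then show ?thesis by (simp add: w_def)
    qed
    ultimately show ?thesis
      using orbit(1)[OF p(1)] w p by (intro exI[of _ ?q]) auto
  qed
  then show thesis using that P P_pos by blast
qed

section \<open>Slowly varying cutoffs\<close>

definition slow_cutoff :: "real \<Rightarrow> nat \<Rightarrow> nat \<Rightarrow> 'a set \<Rightarrow> ('a \<Rightarrow> real) \<Rightarrow> bool" where
  "slow_cutoff e n L B u \<longleftrightarrow> u \<in> borel_measurable M \<and> (\<forall>\<omega>. 0 \<le> u \<omega> \<and> u \<omega> \<le> 1) \<and>
    (\<forall>\<omega>\<in>orbit_nbhd n B. u \<omega> = 1) \<and> (\<forall>\<omega>. \<omega> \<notin> orbit_nbhd L B \<longrightarrow> u \<omega> = 0) \<and>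
    (\<forall>p. integrable M p \<longrightarrow> (\<forall>\<omega>. 0 \<le> p \<omega>) \<longrightarrow>
      renorm (\<lambda>\<omega>. u \<omega> * p \<omega>) + renorm (\<lambda>\<omega>. (1 - u \<omega>) * p \<omega>) \<le> (1 + e) * renorm p)"

text \<open>The average \<open>u\<close> of the indicators of \<open>m\<close> successive orbit neighbourhoods of \<open>B\<close> changes by at most
  \<open>N / m\<close> along \<open>N\<close> steps of an orbit, hence so does \<open>1 - u\<close>. In \<open>renorm_mult_le\<close> the majorants
  \<open>u + N / m\<close> and \<open>1 - u + N / m\<close> add up to a constant close to 1. What matters later is that the
  radius \<open>L\<close> is chosen before \<open>B\<close>.\<close>
lemma slow_cutoff_exists:
  assumes "0 < e"
  shows "\<exists>L. \<forall>B\<in>sets M. \<exists>u. slow_cutoff e n L B u"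
proof -
  have "0 < e * sqrt (a 0) / 2" using assms a_pos[of 0] by simp
  then obtain N where N: "tail {- int N..int N} < e * sqrt (a 0) / 2"
    using small_tail by blast
  obtain m :: nat where m: "4 * N / e < m"
    using reals_Archimedean2 by blast
  have m0: "0 < m" using m assms by (cases m) (auto simp: field_simps)
  have m': "2 * (N / m) \<le> e / 2"
    using m m0 assms by (simp add: field_simps)
  have "\<exists>u. slow_cutoff e n (n + m) B u" if B [measurable]: "B \<in> sets M" for B
  proof -
    define f where "f \<omega> i = (indicator (orbit_nbhd (n + i) B) \<omega> :: real)" for \<omega> i
    define u where "u \<omega> = (\<Sum>i<m. f \<omega> i) / m" for \<omega>
    have f: "0 \<le> f \<omega> i" "f \<omega> i \<le> 1" for \<omega> i
      by (auto simp: f_def)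
    have [measurable]: "u \<in> borel_measurable M"
      unfolding u_def f_def by measurable
    have u: "0 \<le> u \<omega>" "u \<omega> \<le> 1" for \<omega>
    proof -
      show "0 \<le> u \<omega>" by (simp add: u_def sum_nonneg f)
      have "(\<Sum>i<m. f \<omega> i) \<le> (\<Sum>i<m. 1)" by (intro sum_mono f)
      then show "u \<omega> \<le> 1" using m0 by (simp add: u_def)
    qed
    have mono: "orbit_nbhd i B \<subseteq> orbit_nbhd j B" if "i \<le> j" for i j
      using that by (force simp: orbit_nbhd_iff)
    have u1: "u \<omega> = 1" if "\<omega> \<in> orbit_nbhd n B" for \<omega>
    proof -
      have "f \<omega> i = 1" for i using that mono[of n "n + i"] by (auto simp: f_def)
      then show ?thesis using m0 by (simp add: u_def)
    qed
    have u0: "u \<omega> = 0" if "\<omega> \<notin> orbit_nbhd (n + m) B" for \<omega>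
    proof -
      have "f \<omega> i = 0" if "i < m" for i
        using \<open>\<omega> \<notin> orbit_nbhd (n + m) B\<close> that mono[of "n + i" "n + m"]
        by (auto simp: f_def indicator_def)
      then show ?thesis by (simp add: u_def)
    qed
    have up: "u (\<tau> k \<omega>) \<le> u \<omega> + N / m" if "\<omega> \<in> space M" "\<bar>k\<bar> \<le> int N" for \<omega> k
    proof -
      have "(\<Sum>i<m. f (\<tau> k \<omega>) i) \<le> (\<Sum>i<m. f \<omega> (i + N))"
      proof (intro sum_mono)
        fix i
        show "f (\<tau> k \<omega>) i \<le> f \<omega> (i + N)"
          using orbit_nbhd_tau[OF that(1) _ that(2), of "n + i" B]
          by (auto simp: f_def add.assoc split: split_indicator)
      qed
      also have "\<dots> = (\<Sum>i\<in>{N..<m + N}. f \<omega> i)"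
        using sum.shift_bounds_nat_ivl[of "f \<omega>" 0 N m] by (simp add: atLeast0LessThan)
      also have "\<dots> \<le> (\<Sum>i\<in>{..<m} \<union> {m..<m + N}. f \<omega> i)"
        by (intro sum_mono2) (auto simp: f)
      also have "\<dots> = (\<Sum>i<m. f \<omega> i) + (\<Sum>i\<in>{m..<m + N}. f \<omega> i)"
        by (intro sum.union_disjoint) auto
      also have "\<dots> \<le> (\<Sum>i<m. f \<omega> i) + (\<Sum>i\<in>{m..<m + N}. 1)"
        by (intro add_left_mono sum_mono f)
      finally have "(\<Sum>i<m. f (\<tau> k \<omega>) i) \<le> (\<Sum>i<m. f \<omega> i) + N" by simp
      then show ?thesis
        using m0 by (simp add: u_def add_divide_distrib[symmetric] divide_right_mono)
    qed
    have down: "u \<omega> \<le> u (\<tau> k \<omega>) + N / m" if "\<omega> \<in> space M" "\<bar>k\<bar> \<le> int N" for \<omega> k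
      using up[OF tau_space[OF that(1), of k], of "- k"] that
      by (simp add: tau_add[symmetric] tau_zero)
    have "renorm (\<lambda>\<omega>. u \<omega> * p \<omega>) + renorm (\<lambda>\<omega>. (1 - u \<omega>) * p \<omega>) \<le> (1 + e) * renorm p"
      if p: "integrable M p" "\<And>\<omega>. 0 \<le> p \<omega>" for p
    proof -
      have [measurable]: "p \<in> borel_measurable M" using p by auto
      let ?s = "square_fun p" and ?K = "{- int N..int N}"
      have s: "integrable M ?s" by (rule integrable_square_fun[OF p])
      have bounded_mult: "integrable M (\<lambda>\<omega>. v \<omega> * q \<omega>)"
        if "integrable M q" "v \<in> borel_measurable M" "\<And>\<omega>. \<bar>v \<omega>\<bar> \<le> C" for v q and C :: real
        by (rule Bochner_Integration.integrable_bound[of _ "\<lambda>\<omega>. C * q \<omega>"])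
          (use that order_trans[OF abs_ge_zero that(3)] in \<open>auto simp: abs_mult intro!: mult_right_mono\<close>)
      have int: "integrable M (\<lambda>\<omega>. u \<omega> * p \<omega>)" "integrable M (\<lambda>\<omega>. (1 - u \<omega>) * p \<omega>)"
        "integrable M (\<lambda>\<omega>. u \<omega> * ?s \<omega>)"
        using u by (auto intro!: bounded_mult[of _ _ 1] p s)
      have int': "integrable M (\<lambda>\<omega>. (u \<omega> + N / m) * ?s \<omega>)" "integrable M (\<lambda>\<omega>. (1 - u \<omega> + N / m) * ?s \<omega>)"
        unfolding distrib_right left_diff_distrib using int(3) s by auto
      have "renorm (\<lambda>\<omega>. u \<omega> * p \<omega>) \<le> (\<integral>\<omega>. (u \<omega> + N / m) * ?s \<omega> \<partial>M) + tail ?K * (\<integral>\<omega>. u \<omega> * p \<omega> \<partial>M)"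
        using u up by (intro renorm_mult_le p int int') auto
      moreover have "renorm (\<lambda>\<omega>. (1 - u \<omega>) * p \<omega>) \<le>
        (\<integral>\<omega>. (1 - u \<omega> + N / m) * ?s \<omega> \<partial>M) + tail ?K * (\<integral>\<omega>. (1 - u \<omega>) * p \<omega> \<partial>M)"
        using u down
        by (intro renorm_mult_le p int int') (auto simp: algebra_simps intro: add_increasing2)
      moreover have "(\<integral>\<omega>. (u \<omega> + N / m) * ?s \<omega> \<partial>M) + (\<integral>\<omega>. (1 - u \<omega> + N / m) * ?s \<omega> \<partial>M) = renorm p + 2 * (N / m) * renorm p"
      proof -
        have "(u \<omega> + N / m) * ?s \<omega> + (1 - u \<omega> + N / m) * ?s \<omega> = ?s \<omega> + 2 * (N / m) * ?s \<omega>" for \<omega>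
          by (simp add: algebra_simps)
        then show ?thesis
          unfolding renorm_def
          using s by (subst Bochner_Integration.integral_add[symmetric, OF int']) simp
      qed
      moreover have "tail ?K * (\<integral>\<omega>. u \<omega> * p \<omega> \<partial>M) + tail ?K * (\<integral>\<omega>. (1 - u \<omega>) * p \<omega> \<partial>M) = tail ?K * (\<integral>\<omega>. p \<omega> \<partial>M)"
        unfolding distrib_left[symmetric]
        by (subst Bochner_Integration.integral_add[symmetric, OF int(1,2)]) (simp add: algebra_simps)
      moreover have "tail ?K * (\<integral>\<omega>. p \<omega> \<partial>M) \<le> e / 2 * renorm p"
      proof -
        have "tail ?K * (\<integral>\<omega>. p \<omega> \<partial>M) \<le> e * sqrt (a 0) / 2 * (\<integral>\<omega>. p \<omega> \<partial>M)"
          using N p by (intro mult_right_mono) (auto simp: integral_nonneg_AE)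
        also have "\<dots> = e / 2 * (sqrt (a 0) * (\<integral>\<omega>. p \<omega> \<partial>M))" by simp
        also have "\<dots> \<le> e / 2 * renorm p"
          using assms by (intro mult_left_mono integral_le_renorm p) auto
        finally show ?thesis .
      qed
      moreover have "2 * (N / m) * renorm p \<le> e / 2 * renorm p"
        using m' renorm_nonneg by (intro mult_right_mono) auto
      moreover have "(1 + e) * renorm p = renorm p + e / 2 * renorm p + e / 2 * renorm p"
        by (simp add: field_simps)
      ultimately show ?thesis by linarith
    qed
    then show ?thesis
      unfolding slow_cutoff_def using u u0 u1 by (intro exI[of _ u]) auto
  qed
  then show ?thesis by blast
qed

section \<open>Separated small sets\<close>

text \<open>Split repeatedly into two non-null parts and keep one that has at most half the measure.\<close>
lemma small_subset:
  assumes A: "A \<in> sets M" "0 < measure M A" and "0 < \<delta>"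
  obtains B where "B \<in> sets M" "B \<subseteq> A" "0 < measure M B" "measure M B < \<delta>"
proof -
  have "\<exists>B\<in>sets M. B \<subseteq> A \<and> 0 < measure M B \<and> measure M B \<le> measure M A / 2 ^ n" for n
  proof (induction n)
    case 0
    then show ?case using A by auto
  next
    case (Suc n)
    then obtain B where B: "B \<in> sets M" "B \<subseteq> A" "0 < measure M B" "measure M B \<le> measure M A / 2 ^ n"
      by auto
    then obtain C where C: "C \<in> sets M" "C \<subseteq> B" "measure M C \<noteq> 0" "measure M (B - C) \<noteq> 0"
      using atomless by (auto simp: atomless_def emeasure_eq_measure)
    have pos: "0 < measure M C" "0 < measure M (B - C)"
      using C by (auto simp: less_le)
    have sum: "measure M (B - C) = measure M B - measure M C"
      using B C by (simp add: finite_measure_Diff)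
    show ?case
    proof (cases "measure M C \<le> measure M B / 2")
      case True
      then show ?thesis
        using B C pos by (intro bexI[of _ C]) auto
    next
      case False
      then show ?thesis
        using B C pos sum by (intro bexI[of _ "B - C"]) auto
    qed
  qed
  moreover obtain n :: nat where "measure M A / \<delta> < 2 ^ n"
    using real_arch_pow[of 2] by auto
  then have "measure M A / 2 ^ n < \<delta>"
    using assms by (simp add: field_simps)
  ultimately show thesis
    using that by (meson le_less_trans)
qed

text \<open>Choose the first set so small that its orbit neighbourhood of radius \<open>2 * L\<close> does not exhaust \<open>P\<close>,
  and continue in the rest of \<open>P\<close>. The radius is doubled because two neighbourhoods of radius \<open>L\<close>
  that share a point put the sets within orbit distance \<open>2 * L\<close>.\<close>
lemma separated_subsets:
  assumes "P \<in> sets M" "0 < measure M P"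
  shows "\<exists>B :: nat \<Rightarrow> 'a set. (\<forall>i<m. B i \<in> sets M \<and> B i \<subseteq> P \<and> 0 < measure M (B i)) \<and>
    (\<forall>i j. i < j \<longrightarrow> j < m \<longrightarrow> orbit_nbhd L (B i) \<inter> orbit_nbhd L (B j) = {})"
  using assms
proof (induction m arbitrary: P)
  case (Suc m)
  have "0 < measure M P / (2 * real (2 * L) + 1)"
    using Suc.prems by simp
  then obtain A where A: "A \<in> sets M" "A \<subseteq> P" "0 < measure M A"
    and small: "measure M A < measure M P / (2 * real (2 * L) + 1)"
    using small_subset[OF Suc.prems] by blast
  define Q where "Q = P - orbit_nbhd (2 * L) A"
  have "measure M (orbit_nbhd (2 * L) A) \<le> (2 * real (2 * L) + 1) * measure M A"
    using measure_orbit_nbhd_le[OF A(1), of "2 * L"] by simp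
  also have "\<dots> < measure M P"
    using small by (simp add: pos_less_divide_eq mult.commute add_nonneg_pos)
  finally have "0 < measure M Q"
    using measure_Un_le[of "P - orbit_nbhd (2 * L) A" M "orbit_nbhd (2 * L) A"]
      finite_measure_mono[of P "P - orbit_nbhd (2 * L) A \<union> orbit_nbhd (2 * L) A"] A(1) Suc.prems
    by (auto simp: Q_def)
  moreover have "Q \<in> sets M" using A Suc.prems by (auto simp: Q_def)
  ultimately obtain B where B: "\<And>i. i < m \<Longrightarrow> B i \<in> sets M \<and> B i \<subseteq> Q \<and> 0 < measure M (B i)"
    "\<And>i j. i < j \<Longrightarrow> j < m \<Longrightarrow> orbit_nbhd L (B i) \<inter> orbit_nbhd L (B j) = {}"
    using Suc.IH by metis
  have disj: "orbit_nbhd L A \<inter> orbit_nbhd L (B j) = {}" if "j < m" for j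
  proof (rule ccontr)
    assume "orbit_nbhd L A \<inter> orbit_nbhd L (B j) \<noteq> {}"
    then obtain \<omega> where \<omega>A: "\<omega> \<in> orbit_nbhd L A" and "\<omega> \<in> orbit_nbhd L (B j)"
      by blast
    then obtain k where k: "\<bar>k\<bar> \<le> int L" "\<tau> k \<omega> \<in> B j" and \<omega>: "\<omega> \<in> space M" "\<omega> \<in> orbit_nbhd L A"
      unfolding orbit_nbhd_iff[of \<omega> L "B j"] by blast
    have "\<tau> (- k) (\<tau> k \<omega>) \<in> orbit_nbhd L A"
      using \<omega> by (simp add: tau_add[symmetric] tau_zero)
    then have "\<tau> k \<omega> \<in> orbit_nbhd (2 * L) A"
      using orbit_nbhd_tau[of "\<tau> k \<omega>" "- k" L A L] k \<omega> by (simp add: tau_space mult_2)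
    then show False using B(1)[OF that] k by (auto simp: Q_def)
  qed
  show ?case
  proof (intro exI[of _ "case_nat A B"] conjI allI impI)
    fix i assume "i < Suc m"
    then show "case_nat A B i \<in> sets M" "case_nat A B i \<subseteq> P" "0 < measure M (case_nat A B i)"
      using A B(1)[of "i - 1"] by (auto simp: Q_def split: nat.split)
  next
    fix i j assume "i < j" "j < Suc m"
    then show "orbit_nbhd L (case_nat A B i) \<inter> orbit_nbhd L (case_nat A B j) = {}"
      using disj B(2) by (auto split: nat.split)
  qed
qed auto

section \<open>The Daugavet estimate for functionals\<close>

lemma functional_sum:
  fixes F :: "('a \<Rightarrow> 'k::{real_normed_field, second_countable_topology}) \<Rightarrow> 'k"
  assumes add: "\<And>\<Phi> \<Psi>. \<Phi> \<in> ess_bounded M \<Longrightarrow> \<Psi> \<in> ess_bounded M \<Longrightarrow> F (\<lambda>\<omega>. \<Phi> \<omega> + \<Psi> \<omega>) = F \<Phi> + F \<Psi>"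
    and scale: "\<And>c \<Phi>. \<Phi> \<in> ess_bounded M \<Longrightarrow> F (\<lambda>\<omega>. c * \<Phi> \<omega>) = c * F \<Phi>"
    and \<Phi>: "\<And>i. i \<in> I \<Longrightarrow> \<Phi> i \<in> ess_bounded M"
  shows "F (\<lambda>\<omega>. \<Sum>i\<in>I. \<Phi> i \<omega>) = (\<Sum>i\<in>I. F (\<Phi> i))"
proof -
  have zero: "F (\<lambda>_. 0) = 0"
    using scale[OF ess_bounded_zero, of 0] by simp
  show ?thesis
    using \<Phi> by (induction I rule: infinite_finite_induct) (auto simp: zero add ess_bounded_sum)
qed

text \<open>Rotate each piece \<open>u i * \<Theta>\<close> by a phase that makes \<open>F\<close> nonnegative on it. Since the supports are
  disjoint, the sum of the rotated pieces is dominated by \<open>|\<Theta>|\<close>; so the values of \<open>|F|\<close> on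
  the \<open>m\<close> pieces add up to at most \<open>C * |||\<Theta>|||\<^sub>*\<close>, and the smallest is at most the mean. Only
  finite additivity of \<open>F\<close> is involved, so singular functionals are covered.\<close>
lemma functional_small_on_disjoint_cutoff:
  fixes F :: "('a \<Rightarrow> 'k::{real_normed_field, banach, second_countable_topology}) \<Rightarrow> 'k" and m :: nat
  assumes add: "\<And>\<Phi> \<Psi>. \<Phi> \<in> ess_bounded M \<Longrightarrow> \<Psi> \<in> ess_bounded M \<Longrightarrow> F (\<lambda>\<omega>. \<Phi> \<omega> + \<Psi> \<omega>) = F \<Phi> + F \<Psi>"
    and scale: "\<And>c \<Phi>. \<Phi> \<in> ess_bounded M \<Longrightarrow> F (\<lambda>\<omega>. c * \<Phi> \<omega>) = c * F \<Phi>"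
    and bound: "\<And>\<Phi>. \<Phi> \<in> ess_bounded M \<Longrightarrow> norm (F \<Phi>) \<le> C * dual_norm M T a \<Phi>" "0 \<le> C"
    and \<Theta>: "\<Theta> \<in> ess_bounded M" and m: "0 < m"
    and u: "\<And>i. i < m \<Longrightarrow> u i \<in> borel_measurable M"
      "\<And>i \<omega>. i < m \<Longrightarrow> 0 \<le> u i \<omega>" "\<And>i \<omega>. i < m \<Longrightarrow> u i \<omega> \<le> (1::real)"
    and disj: "\<And>i j \<omega>. i < j \<Longrightarrow> j < m \<Longrightarrow> u i \<omega> = 0 \<or> u j \<omega> = 0"
  shows "\<exists>i<m. m * norm (F (\<lambda>\<omega>. of_real (u i \<omega>) * \<Theta> \<omega>)) \<le> C * dual_norm M T a \<Theta>"
proof -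
  define z where "z i = F (\<lambda>\<omega>. of_real (u i \<omega>) * \<Theta> \<omega>)" for i
  define G where "G \<omega> = (\<Sum>i<m. conj_phase (z i) * (of_real (u i \<omega>) * \<Theta> \<omega>))" for \<omega>
  have uB: "(\<lambda>\<omega>. of_real (u i \<omega>) * \<Theta> \<omega>) \<in> ess_bounded M" if "i < m" for i
    using u that by (intro ess_bounded_mult ess_bounded_of_real \<Theta>) auto
  have pB: "(\<lambda>\<omega>. conj_phase (z i) * (of_real (u i \<omega>) * \<Theta> \<omega>)) \<in> ess_bounded M" if "i < m" for i
    using that by (intro ess_bounded_mult[OF ess_bounded_const] uB)
  have G: "G \<in> ess_bounded M"
    unfolding G_def[abs_def] by (intro ess_bounded_sum pB) auto
  have "F G = (\<Sum>i<m. conj_phase (z i) * z i)"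
    unfolding G_def[abs_def] z_def
    by (subst functional_sum[OF add scale]) (auto simp: scale uB pB[unfolded z_def])
  also have "\<dots> = of_real (\<Sum>i<m. norm (z i))"
    by (simp add: conj_phase_mult)
  finally have "(\<Sum>i<m. norm (z i)) = norm (F G)"
    by (simp add: sum_nonneg flip: of_real_sum)
  also have "\<dots> \<le> C * dual_norm M T a G"
    by (rule bound(1)[OF G])
  also have "\<dots> \<le> C * dual_norm M T a \<Theta>"
  proof (intro mult_left_mono dual_norm_mono G \<Theta> bound(2) AE_I2)
    fix \<omega>
    have "norm (G \<omega>) \<le> (\<Sum>i<m. norm (conj_phase (z i) * (of_real (u i \<omega>) * \<Theta> \<omega>)))"
      unfolding G_def by (rule norm_sum)
    also have "\<dots> = (\<Sum>i<m. u i \<omega>) * norm (\<Theta> \<omega>)"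
      using u by (simp add: norm_mult sum_distrib_right)
    also have "\<dots> \<le> 1 * norm (\<Theta> \<omega>)"
    proof (intro mult_right_mono)
      show "(\<Sum>i<m. u i \<omega>) \<le> 1"
      proof (cases "\<exists>i<m. u i \<omega> \<noteq> 0")
        case True
        then obtain i where i: "i < m" "u i \<omega> \<noteq> 0" by auto
        have "u j \<omega> = 0" if "j < m" "j \<noteq> i" for j
          using disj[of i j \<omega>] disj[of j i \<omega>] that i by (cases "i < j") auto
        then have "(\<Sum>j<m. u j \<omega>) = (\<Sum>j\<in>{i}. u j \<omega>)"
          using i by (intro sum.mono_neutral_right) auto
        then show ?thesis using u i by simp
      next
        case False
        then show ?thesis by simp
      qed
    qed simp
    finally show "norm (G \<omega>) \<le> norm (\<Theta> \<omega>)" by simp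
  qed
  finally have sum_le: "(\<Sum>i<m. norm (z i)) \<le> C * dual_norm M T a \<Theta>" .
  show ?thesis
  proof (rule ccontr)
    assume "\<not> ?thesis"
    then have "C * dual_norm M T a \<Theta> / m < norm (z i)" if "i < m" for i
      using that m by (auto simp: z_def field_simps not_le)
    then have "(\<Sum>i<m. C * dual_norm M T a \<Theta> / m) < (\<Sum>i<m. norm (z i))"
      using m by (intro sum_strict_mono) auto
    then show False using sum_le m by simp
  qed
qed

text \<open>The perturbation is \<open>\<Phi>' = (1 - u) \<Phi> + u c \<Psi> = \<Phi> + u \<Theta>\<close> with \<open>\<Theta> = c \<Psi> - \<Phi>\<close>, where \<open>c\<close> is the
  phase for which \<open>c \<Psi>\<close> and \<open>F(\<Phi>) \<Psi>\<close> point in the same direction. The cutoff \<open>u\<close> is chosen among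
  disjointly supported ones so that \<open>F\<close> is small on \<open>u \<Theta>\<close>.\<close>
lemma daugavet_perturbation:
  fixes F :: "('a \<Rightarrow> 'k::{real_normed_field, banach, second_countable_topology}) \<Rightarrow> 'k"
  assumes add: "\<And>\<Phi> \<Psi>. \<Phi> \<in> ess_bounded M \<Longrightarrow> \<Psi> \<in> ess_bounded M \<Longrightarrow> F (\<lambda>\<omega>. \<Phi> \<omega> + \<Psi> \<omega>) = F \<Phi> + F \<Psi>"
    and scale: "\<And>c \<Phi>. \<Phi> \<in> ess_bounded M \<Longrightarrow> F (\<lambda>\<omega>. c * \<Phi> \<omega>) = c * F \<Phi>"
    and bound: "\<And>\<Phi>. \<Phi> \<in> ess_bounded M \<Longrightarrow> norm (F \<Phi>) \<le> C * dual_norm M T a \<Phi>" "0 \<le> C"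
    and \<Psi>: "\<Psi> \<in> ess_bounded M" "dual_norm M T a \<Psi> = 1"
    and \<Phi>: "\<Phi> \<in> ess_bounded M" "dual_norm M T a \<Phi> \<le> 1"
    and e: "0 < e" "e < 1"
  shows "\<exists>\<Phi>'\<in>ess_bounded M. dual_norm M T a \<Phi>' \<le> 1 + e \<and> norm (F \<Phi>' - F \<Phi>) \<le> e \<and>
    (1 + norm (F \<Phi>)) * (1 - e) \<le> dual_norm M T a (\<lambda>\<omega>. \<Phi>' \<omega> + F \<Phi> * \<Psi> \<omega>)"
proof -
  let ?dn = "dual_norm M T a"
  define z where "z = F \<Phi>"
  obtain c where c: "norm c = 1" "c * of_real (norm z) = z"
  proof (cases "z = 0")
    case True
    then show ?thesis using that[of 1] by simp
  next
    case False
    then show ?thesis using that[of "z / of_real (norm z)"] by (simp add: norm_divide)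
  qed
  define \<Theta> where "\<Theta> \<omega> = c * \<Psi> \<omega> + (- 1) * \<Phi> \<omega>" for \<omega>
  have \<Theta>: "\<Theta> \<in> ess_bounded M"
    unfolding \<Theta>_def[abs_def] by (intro ess_bounded_add ess_bounded_mult[OF ess_bounded_const] \<Psi> \<Phi>)
  have e1: "0 \<le> 1 - e" "1 - e < ?dn \<Psi>" using e \<Psi> by auto
  obtain P n where P: "P \<in> sets M" "0 < measure M P"
    and norming: "\<And>B. B \<in> sets M \<Longrightarrow> B \<subseteq> P \<Longrightarrow> 0 < measure M B \<Longrightarrow>
      \<exists>p. integrable M p \<and> (\<forall>\<omega>. 0 \<le> p \<omega>) \<and> (\<forall>\<omega>\<in>space M - orbit_nbhd n B. p \<omega> = 0) \<and>
          (1 - e) * renorm p < (\<integral>\<omega>. norm (\<Psi> \<omega>) * p \<omega> \<partial>M)"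
    by (rule norming_density_near_small_sets[OF \<Psi>(1) e1]) blast
  obtain L where cutoff: "\<And>B. B \<in> sets M \<Longrightarrow> \<exists>u. slow_cutoff e n L B u"
    using slow_cutoff_exists[OF e(1)] by blast
  obtain m :: nat where m: "C * ?dn \<Theta> / e < m"
    using reals_Archimedean2 by blast
  moreover have "0 \<le> C * ?dn \<Theta> / e"
    using bound(2) e dual_norm_nonneg[OF \<Theta>] by simp
  ultimately have m0: "0 < m" by (cases m) auto
  obtain B where B: "\<And>i. i < m \<Longrightarrow> B i \<in> sets M \<and> B i \<subseteq> P \<and> 0 < measure M (B i)"
    and sep: "\<And>i j. i < j \<Longrightarrow> j < m \<Longrightarrow> orbit_nbhd L (B i) \<inter> orbit_nbhd L (B j) = {}"
    using separated_subsets[OF P, of m L] by blast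
  have "\<forall>i. \<exists>u. i < m \<longrightarrow> slow_cutoff e n L (B i) u"
    using B cutoff by blast
  from choice[OF this] obtain u where u: "\<And>i. i < m \<Longrightarrow> slow_cutoff e n L (B i) (u i)"
    by blast
  have "\<exists>i<m. m * norm (F (\<lambda>\<omega>. of_real (u i \<omega>) * \<Theta> \<omega>)) \<le> C * ?dn \<Theta>"
  proof (rule functional_small_on_disjoint_cutoff[OF add scale bound \<Theta> m0])
    fix i j \<omega> assume ij: "i < j" "j < m"
    then show "u i \<omega> = 0 \<or> u j \<omega> = 0"
      using sep[OF ij] u[of i] u[of j] unfolding slow_cutoff_def
      by (metis IntI empty_iff less_trans)
  qed (use u in \<open>auto simp: slow_cutoff_def\<close>)
  then obtain i where i: "i < m" and Fi: "m * norm (F (\<lambda>\<omega>. of_real (u i \<omega>) * \<Theta> \<omega>)) \<le> C * ?dn \<Theta>"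
    by blast
  define v where "v = u i"
  have v [measurable]: "v \<in> borel_measurable M"
    and v01: "\<And>\<omega>. 0 \<le> v \<omega>" "\<And>\<omega>. v \<omega> \<le> 1"
    and v1: "\<And>\<omega>. \<omega> \<in> orbit_nbhd n (B i) \<Longrightarrow> v \<omega> = 1"
    and v_renorm: "\<And>p. integrable M p \<Longrightarrow> (\<And>\<omega>. 0 \<le> p \<omega>) \<Longrightarrow>
      renorm (\<lambda>\<omega>. v \<omega> * p \<omega>) + renorm (\<lambda>\<omega>. (1 - v \<omega>) * p \<omega>) \<le> (1 + e) * renorm p"
    using u[OF i] by (auto simp: v_def slow_cutoff_def)
  define \<Phi>' where "\<Phi>' \<omega> = \<Phi> \<omega> + of_real (v \<omega>) * \<Theta> \<omega>" for \<omega>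
  have v\<Theta>: "(\<lambda>\<omega>. of_real (v \<omega>) * \<Theta> \<omega>) \<in> ess_bounded M"
    using v01 by (intro ess_bounded_mult ess_bounded_of_real \<Theta> v) auto
  have \<Phi>': "\<Phi>' \<in> ess_bounded M"
    unfolding \<Phi>'_def[abs_def] by (rule ess_bounded_add[OF \<Phi>(1) v\<Theta>])
  have "F \<Phi>' - F \<Phi> = F (\<lambda>\<omega>. of_real (v \<omega>) * \<Theta> \<omega>)"
    unfolding \<Phi>'_def[abs_def] by (subst add[OF \<Phi>(1) v\<Theta>]) simp
  moreover have "norm (F (\<lambda>\<omega>. of_real (v \<omega>) * \<Theta> \<omega>)) \<le> e"
  proof -
    have "m * norm (F (\<lambda>\<omega>. of_real (v \<omega>) * \<Theta> \<omega>)) \<le> m * e"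
      using Fi m e by (simp add: v_def field_simps)
    then show ?thesis using m0 by simp
  qed
  ultimately have F\<Phi>': "norm (F \<Phi>' - F \<Phi>) \<le> e" by simp
  \<comment> \<open>\<open>\<Phi>'\<close> is a pointwise convex combination of \<open>\<Phi>\<close> and \<open>c \<Psi>\<close>, both in the unit ball.\<close>
  have upper: "?dn \<Phi>' \<le> 1 + e"
  proof (rule dual_norm_least)
    fix q assume q: "integrable M q" "\<And>\<omega>. 0 \<le> q \<omega>" "renorm q \<le> 1"
    have [measurable]: "q \<in> borel_measurable M" using q by auto
    have int: "integrable M (\<lambda>\<omega>. v \<omega> * q \<omega>)" "integrable M (\<lambda>\<omega>. (1 - v \<omega>) * q \<omega>)"
      using v01 q by (auto intro!: Bochner_Integration.integrable_bound[OF q(1)] AE_I2 mult_left_le_one_le simp: abs_mult)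
    have "norm (\<Phi>' \<omega>) * q \<omega> \<le> norm (\<Phi> \<omega>) * ((1 - v \<omega>) * q \<omega>) + norm (\<Psi> \<omega>) * (v \<omega> * q \<omega>)" for \<omega>
    proof -
      have "\<Phi>' \<omega> = of_real (1 - v \<omega>) * \<Phi> \<omega> + of_real (v \<omega>) * (c * \<Psi> \<omega>)"
        by (simp add: \<Phi>'_def \<Theta>_def algebra_simps)
      then have "norm (\<Phi>' \<omega>) \<le> norm (of_real (1 - v \<omega>) * \<Phi> \<omega>) + norm (of_real (v \<omega>) * (c * \<Psi> \<omega>))"
        by (simp only: norm_triangle_ineq)
      also have "\<dots> = (1 - v \<omega>) * norm (\<Phi> \<omega>) + v \<omega> * norm (\<Psi> \<omega>)"
        using v01[of \<omega>] c by (simp add: norm_mult del: of_real_diff)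
      finally have "norm (\<Phi>' \<omega>) * q \<omega> \<le> ((1 - v \<omega>) * norm (\<Phi> \<omega>) + v \<omega> * norm (\<Psi> \<omega>)) * q \<omega>"
        using q by (intro mult_right_mono) auto
      then show ?thesis by (simp add: algebra_simps)
    qed
    then have "(\<integral>\<omega>. norm (\<Phi>' \<omega>) * q \<omega> \<partial>M) \<le>
      (\<integral>\<omega>. norm (\<Phi> \<omega>) * ((1 - v \<omega>) * q \<omega>) + norm (\<Psi> \<omega>) * (v \<omega> * q \<omega>) \<partial>M)"
      by (intro integral_mono integrable_ess_bounded_mult \<Phi>' \<Phi> \<Psi> q int Bochner_Integration.integrable_add)
    also have "\<dots> = (\<integral>\<omega>. norm (\<Phi> \<omega>) * ((1 - v \<omega>) * q \<omega>) \<partial>M) + (\<integral>\<omega>. norm (\<Psi> \<omega>) * (v \<omega> * q \<omega>) \<partial>M)"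
      by (intro Bochner_Integration.integral_add integrable_ess_bounded_mult \<Phi> \<Psi> int)
    also have "\<dots> \<le> ?dn \<Phi> * renorm (\<lambda>\<omega>. (1 - v \<omega>) * q \<omega>) + ?dn \<Psi> * renorm (\<lambda>\<omega>. v \<omega> * q \<omega>)"
      using v01 q by (intro add_mono dual_norm_upper \<Phi> \<Psi> int) auto
    also have "\<dots> \<le> 1 * renorm (\<lambda>\<omega>. (1 - v \<omega>) * q \<omega>) + 1 * renorm (\<lambda>\<omega>. v \<omega> * q \<omega>)"
      using \<Phi> \<Psi> by (intro add_mono mult_right_mono renorm_nonneg) auto
    also have "\<dots> \<le> (1 + e) * renorm q"
      using v_renorm[OF q(1,2)] by simp
    also have "\<dots> \<le> 1 + e"
      using q e by (intro mult_left_le) auto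
    finally show "(\<integral>\<omega>. norm (\<Phi>' \<omega>) * q \<omega> \<partial>M) \<le> 1 + e" .
  qed
  \<comment> \<open>The cutoff is 1 wherever \<open>p\<close> lives, so there \<open>\<Phi>' + z \<Psi>\<close> is \<open>c \<Psi> + z \<Psi>\<close>, and no cancellation occurs.\<close>
  obtain p where p: "integrable M p" "\<And>\<omega>. 0 \<le> p \<omega>"
    and supp: "\<And>\<omega>. \<omega> \<in> space M \<Longrightarrow> \<omega> \<notin> orbit_nbhd n (B i) \<Longrightarrow> p \<omega> = 0"
    and p_norming: "(1 - e) * renorm p < (\<integral>\<omega>. norm (\<Psi> \<omega>) * p \<omega> \<partial>M)"
    using norming[of "B i"] B[OF i] by blast
  have "(\<integral>\<omega>. norm (\<Psi> \<omega>) * p \<omega> \<partial>M) \<le> renorm p"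
    using dual_norm_upper[OF \<Psi>(1) p] \<Psi>(2) by simp
  then have "0 < e * renorm p" using p_norming by (simp add: algebra_simps)
  then have p_pos: "0 < renorm p" using e by (simp add: zero_less_mult_iff)
  let ?S = "\<lambda>\<omega>. \<Phi>' \<omega> + z * \<Psi> \<omega>"
  have S: "?S \<in> ess_bounded M"
    by (intro ess_bounded_add \<Phi>' ess_bounded_mult[OF ess_bounded_const] \<Psi>)
  have "(1 + norm z) * (1 - e) * renorm p \<le> (1 + norm z) * (\<integral>\<omega>. norm (\<Psi> \<omega>) * p \<omega> \<partial>M)"
    unfolding mult.assoc using p_norming by (intro mult_left_mono) auto
  also have "\<dots> = (\<integral>\<omega>. (1 + norm z) * (norm (\<Psi> \<omega>) * p \<omega>) \<partial>M)"
    by simp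
  also have "\<dots> = (\<integral>\<omega>. norm (?S \<omega>) * p \<omega> \<partial>M)"
  proof (intro Bochner_Integration.integral_cong refl)
    fix \<omega> assume \<omega>: "\<omega> \<in> space M"
    show "(1 + norm z) * (norm (\<Psi> \<omega>) * p \<omega>) = norm (?S \<omega>) * p \<omega>"
    proof (cases "\<omega> \<in> orbit_nbhd n (B i)")
      case True
      have "?S \<omega> = c * \<Psi> \<omega> + c * of_real (norm z) * \<Psi> \<omega>"
        using v1[OF True] c(2) by (simp add: \<Phi>'_def \<Theta>_def)
      also have "\<dots> = c * of_real (1 + norm z) * \<Psi> \<omega>"
        by (simp add: algebra_simps)
      finally have "norm (?S \<omega>) = norm c * norm (of_real (1 + norm z) :: 'k) * norm (\<Psi> \<omega>)"
        by (simp only: norm_mult)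
      also have "norm (of_real (1 + norm z) :: 'k) = 1 + norm z"
        unfolding norm_of_real by simp
      finally show ?thesis by (simp add: c(1))
    next
      case False
      then show ?thesis using supp[OF \<omega>] by simp
    qed
  qed
  also have "\<dots> \<le> ?dn ?S * renorm p"
    by (rule dual_norm_upper[OF S p])
  finally have "(1 + norm z) * (1 - e) \<le> ?dn ?S"
    using p_pos by simp
  then show ?thesis
    using \<Phi>' upper F\<Phi>' by (auto simp: z_def intro!: bexI[of _ \<Phi>'])
qed

section \<open>The dual space as a normed structure\<close>

lemma equiv_ae_rel: "equiv (ess_bounded M) (ae_rel M :: (('a \<Rightarrow> 'k::real_normed_field) \<times> _) set)"
proof (rule equivI)
  show "sym (ae_rel M :: (('a \<Rightarrow> 'k) \<times> _) set)"
    by (auto simp: sym_def ae_rel_def elim: eventually_mono)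
  show "trans (ae_rel M :: (('a \<Rightarrow> 'k) \<times> _) set)"
    by (auto simp: trans_def ae_rel_def elim: eventually_elim2)
qed (auto simp: refl_on_def ae_rel_def)

definition ae_class :: "('a \<Rightarrow> 'k::real_normed_field) \<Rightarrow> ('a \<Rightarrow> 'k) set" where
  "ae_class \<Phi> = ae_rel M `` {\<Phi>}"

lemma ae_class_eq_iff:
  assumes "\<Phi> \<in> ess_bounded M" "\<Psi> \<in> ess_bounded M"
  shows "ae_class \<Phi> = ae_class \<Psi> \<longleftrightarrow> (AE \<omega> in M. \<Phi> \<omega> = \<Psi> \<omega>)"
  unfolding ae_class_def eq_equiv_class_iff[OF equiv_ae_rel assms]
  using assms by (simp add: ae_rel_def)

context
  fixes Y :: "('k::{real_normed_field, banach, second_countable_topology}, ('a \<Rightarrow> 'k) set) normed_structure"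
  defines "Y \<equiv> dual_space M T a"
begin

lemma vcarrier_cases:
  assumes "x \<in> vcarrier Y"
  obtains \<Phi> where "\<Phi> \<in> ess_bounded M" "x = ae_class \<Phi>"
  using assms by (auto simp: Y_def dual_space_def ae_class_def elim: quotientE)

lemma ae_class_carrier: "\<Phi> \<in> ess_bounded M \<Longrightarrow> ae_class \<Phi> \<in> vcarrier Y"
  by (auto simp: Y_def dual_space_def ae_class_def intro: quotientI)

lemma vzero_eq: "vzero Y = ae_class (\<lambda>_. 0)"
  by (simp add: Y_def dual_space_def ae_class_def)

lemma vadd_ae_class:
  assumes "\<Phi> \<in> ess_bounded M" "\<Psi> \<in> ess_bounded M"
  shows "vadd Y (ae_class \<Phi>) (ae_class \<Psi>) = ae_class (\<lambda>\<omega>. \<Phi> \<omega> + \<Psi> \<omega>)"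
proof -
  have "congruent2 (ae_rel M) (ae_rel M) (\<lambda>\<Phi> \<Psi> :: 'a \<Rightarrow> 'k. ae_class (\<lambda>\<omega>. \<Phi> \<omega> + \<Psi> \<omega>))"
  proof (rule congruent2I')
    fix f f' g g' :: "'a \<Rightarrow> 'k"
    assume "(f, f') \<in> ae_rel M" "(g, g') \<in> ae_rel M"
    then show "ae_class (\<lambda>\<omega>. f \<omega> + g \<omega>) = ae_class (\<lambda>\<omega>. f' \<omega> + g' \<omega>)"
      by (subst ae_class_eq_iff) (auto simp: ae_rel_def intro: ess_bounded_add elim: eventually_elim2)
  qed
  from UN_equiv_class2[OF equiv_ae_rel equiv_ae_rel this assms]
  show ?thesis by (simp add: Y_def dual_space_def ae_class_def)
qed

lemma vscale_ae_class:
  assumes "\<Phi> \<in> ess_bounded M"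
  shows "vscale Y c (ae_class \<Phi>) = ae_class (\<lambda>\<omega>. c * \<Phi> \<omega>)"
proof -
  have "congruent (ae_rel M) (\<lambda>\<Phi> :: 'a \<Rightarrow> 'k. ae_class (\<lambda>\<omega>. c * \<Phi> \<omega>))"
  proof (rule congruentI)
    fix f g :: "'a \<Rightarrow> 'k" assume "(f, g) \<in> ae_rel M"
    then show "ae_class (\<lambda>\<omega>. c * f \<omega>) = ae_class (\<lambda>\<omega>. c * g \<omega>)"
      by (subst ae_class_eq_iff)
        (auto simp: ae_rel_def intro: ess_bounded_mult ess_bounded_const elim: eventually_mono)
  qed
  from UN_equiv_class[OF equiv_ae_rel this assms]
  show ?thesis by (simp add: Y_def dual_space_def ae_class_def)
qed

lemma vnorm_ae_class:
  assumes "\<Phi> \<in> ess_bounded M"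
  shows "vnorm Y (ae_class \<Phi>) = dual_norm M T a \<Phi>"
proof -
  have "the_elem (dual_norm M T a ` ae_class \<Phi>) = dual_norm M T a \<Phi>"
  proof (rule the_elem_image_unique)
    show "ae_class \<Phi> \<noteq> {}"
      unfolding ae_class_def using equiv_class_self[OF equiv_ae_rel assms] by blast
    show "dual_norm M T a \<Psi> = dual_norm M T a \<Phi>" if "\<Psi> \<in> ae_class \<Phi>" for \<Psi>
      using that by (intro dual_norm_cong) (auto simp: ae_class_def ae_rel_def)
  qed
  then show ?thesis by (simp add: Y_def dual_space_def)
qed

lemma ess_bounded_cmult: "\<Phi> \<in> ess_bounded M \<Longrightarrow> (\<lambda>\<omega>. c * \<Phi> \<omega> :: 'k) \<in> ess_bounded M"
  by (intro ess_bounded_mult ess_bounded_const)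

lemma ess_bounded_minus: "\<Phi> \<in> ess_bounded M \<Longrightarrow> (\<lambda>\<omega>. - \<Phi> \<omega> :: 'k) \<in> ess_bounded M"
  using ess_bounded_cmult[of \<Phi> "- 1"] by simp

lemmas ae_class_simps = vzero_eq vadd_ae_class vscale_ae_class vnorm_ae_class
  ess_bounded_zero ess_bounded_add ess_bounded_cmult ess_bounded_minus ae_class_carrier

lemma dual_norm_eq_zero_iff:
  fixes \<Phi> :: "'a \<Rightarrow> 'k"
  assumes "\<Phi> \<in> ess_bounded M"
  shows "dual_norm M T a \<Phi> = 0 \<longleftrightarrow> (AE \<omega> in M. \<Phi> \<omega> = 0)"
proof
  assume "dual_norm M T a \<Phi> = 0"
  then show "AE \<omega> in M. \<Phi> \<omega> = 0"
    using AE_norm_le_dual_norm[OF assms] by simp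
next
  assume "AE \<omega> in M. \<Phi> \<omega> = 0"
  then have "dual_norm M T a \<Phi> \<le> 0 / sqrt (a 0)"
    by (intro dual_norm_le_bound assms) auto
  then show "dual_norm M T a \<Phi> = 0"
    using dual_norm_nonneg[OF assms] by simp
qed

lemma normed_space_dual: "normed_space_on Y"
proof -
  have "vector_space_on Y"
    unfolding vector_space_on_def
    by (auto elim!: vcarrier_cases simp: ae_class_simps algebra_simps)
  moreover have "\<forall>x\<in>vcarrier Y. 0 \<le> vnorm Y x"
    by (auto elim!: vcarrier_cases simp: ae_class_simps dual_norm_nonneg)
  moreover have "\<forall>x\<in>vcarrier Y. vnorm Y x = 0 \<longleftrightarrow> x = vzero Y"
  proof
    fix x assume "x \<in> vcarrier Y"
    then obtain \<Phi> where \<Phi>: "\<Phi> \<in> ess_bounded M" "x = ae_class \<Phi>"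
      by (rule vcarrier_cases)
    then show "vnorm Y x = 0 \<longleftrightarrow> x = vzero Y"
      by (simp add: ae_class_simps dual_norm_eq_zero_iff ae_class_eq_iff)
  qed
  moreover have "\<forall>c. \<forall>x\<in>vcarrier Y. vnorm Y (vscale Y c x) = norm c * vnorm Y x"
    by (auto elim!: vcarrier_cases simp: ae_class_simps dual_norm_cmult)
  moreover have "\<forall>x\<in>vcarrier Y. \<forall>y\<in>vcarrier Y. vnorm Y (vadd Y x y) \<le> vnorm Y x + vnorm Y y"
    by (auto elim!: vcarrier_cases simp: ae_class_simps dual_norm_add)
  ultimately show ?thesis
    by (simp add: normed_space_on_def)
qed

lemma vdist_ae_class:
  assumes "\<Phi> \<in> ess_bounded M" "\<Psi> \<in> ess_bounded M"
  shows "vdist Y (ae_class \<Phi>) (ae_class \<Psi>) = dual_norm M T a (\<lambda>\<omega>. \<Phi> \<omega> + (- 1) * \<Psi> \<omega>)"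
  using assms ess_bounded_cmult[of \<Psi> "- 1"] ess_bounded_add[of \<Phi> "\<lambda>\<omega>. (- 1) * \<Psi> \<omega>"]
  by (simp only: vdist_def vscale_ae_class vadd_ae_class vnorm_ae_class)

text \<open>Off one null set, a Cauchy sequence of representatives is uniformly Cauchy by
  \<open>AE_norm_le_dual_norm\<close>; the uniform limit is a limit in the dual norm by \<open>dual_norm_le_bound\<close>.\<close>
lemma banach_space_dual: "banach_space_on Y"
  unfolding banach_space_on_def
proof (intro conjI normed_space_dual allI impI)
  fix w :: "nat \<Rightarrow> ('a \<Rightarrow> 'k) set"
  assume w: "range w \<subseteq> vcarrier Y \<and> (\<forall>e>0. \<exists>N. \<forall>m\<ge>N. \<forall>n\<ge>N. vdist Y (w m) (w n) < e)"
  then have "\<exists>\<Phi>. \<Phi> \<in> ess_bounded M \<and> w n = ae_class \<Phi>" for n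
    by (metis range_subsetD vcarrier_cases)
  then obtain U where U: "\<And>n. U n \<in> ess_bounded M" "\<And>n. w n = ae_class (U n)"
    by metis
  have [measurable]: "U n \<in> borel_measurable M" for n
    by (rule ess_boundedD[OF U(1)])
  define d where "d m n = vdist Y (w m) (w n)" for m n
  define V where "V \<omega> = lim (\<lambda>n. U n \<omega>)" for \<omega>
  have V [measurable]: "V \<in> borel_measurable M"
    unfolding V_def by measurable
  have t: "0 \<le> tail {}" by (rule tail_nonneg)
  have "AE \<omega> in M. \<forall>m n. norm (U m \<omega> - U n \<omega>) \<le> tail {} * d m n"
    using AE_norm_le_dual_norm[OF ess_bounded_add[OF U(1) ess_bounded_cmult[OF U(1), of "- 1"]]]
    by (simp add: AE_all_countable d_def U(2) vdist_ae_class[OF U(1) U(1)])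
  then have limit: "AE \<omega> in M. \<forall>e>0. \<forall>N. (\<forall>m\<ge>N. \<forall>n\<ge>N. d m n < e) \<longrightarrow>
    (\<forall>n\<ge>N. norm (U n \<omega> - V \<omega>) \<le> tail {} * e)"
  proof eventually_elim
    case (elim \<omega>)
    have "Cauchy (\<lambda>n. U n \<omega>)"
    proof (rule CauchyI)
      fix e :: real assume e: "0 < e"
      then have "0 < e / (tail {} + 1)" using t by simp
      then obtain N where N: "\<And>m n. m \<ge> N \<Longrightarrow> n \<ge> N \<Longrightarrow> d m n < e / (tail {} + 1)"
        using w unfolding d_def by meson
      have "norm (U m \<omega> - U n \<omega>) < e" if "m \<ge> N" "n \<ge> N" for m n
      proof -
        have "norm (U m \<omega> - U n \<omega>) \<le> tail {} * (e / (tail {} + 1))"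
          using elim N[OF that] t by (meson less_imp_le mult_left_mono order_trans)
        also have "\<dots> < e" using e t by (simp add: field_simps)
        finally show ?thesis .
      qed
      then show "\<exists>N. \<forall>m\<ge>N. \<forall>n\<ge>N. norm (U m \<omega> - U n \<omega>) < e" by blast
    qed
    then have lim: "(\<lambda>n. U n \<omega>) \<longlonglongrightarrow> V \<omega>"
      unfolding V_def by (simp add: Cauchy_convergent_iff convergent_LIMSEQ_iff)
    show ?case
    proof (intro allI impI)
      fix e :: real and N n :: nat
      assume e: "0 < e" and N: "\<forall>m\<ge>N. \<forall>n\<ge>N. d m n < e" and n: "N \<le> n"
      have "(\<lambda>m. norm (U n \<omega> - U m \<omega>)) \<longlonglongrightarrow> norm (U n \<omega> - V \<omega>)"
        by (intro tendsto_intros lim)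
      moreover have "\<exists>N. \<forall>m\<ge>N. norm (U n \<omega> - U m \<omega>) \<le> tail {} * e"
        using elim N n t by (meson less_imp_le mult_left_mono order_trans)
      ultimately show "norm (U n \<omega> - V \<omega>) \<le> tail {} * e"
        by (rule LIMSEQ_le_const2)
    qed
  qed
  have near: "AE \<omega> in M. norm (U n \<omega> - V \<omega>) \<le> tail {} * e"
    if "0 < e" "\<And>m n. N \<le> m \<Longrightarrow> N \<le> n \<Longrightarrow> d m n < e" "N \<le> n" for e N n
    using limit by eventually_elim (use that in blast)
  have VB: "V \<in> ess_bounded M"
  proof -
    obtain N where N: "\<And>m n. m \<ge> N \<Longrightarrow> n \<ge> N \<Longrightarrow> d m n < 1"
      using w unfolding d_def by (meson zero_less_one)
    obtain C where "AE \<omega> in M. norm (U N \<omega>) \<le> C"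
      using ess_boundedD(2)[OF U(1)] by blast
    moreover have "AE \<omega> in M. norm (U N \<omega> - V \<omega>) \<le> tail {} * 1"
      by (rule near[of 1 N]) (use N in auto)
    ultimately have "AE \<omega> in M. norm (V \<omega>) \<le> C + tail {}"
    proof eventually_elim
      case (elim \<omega>)
      then show ?case using norm_triangle_sub[of "V \<omega>" "U N \<omega>"] by (simp add: norm_minus_commute)
    qed
    then show ?thesis by (auto simp: ess_bounded_def)
  qed
  show "\<exists>x\<in>vcarrier Y. (\<lambda>n. vdist Y (w n) x) \<longlonglongrightarrow> 0"
  proof (intro bexI[OF _ ae_class_carrier[OF VB]] LIMSEQ_I)
    fix e :: real assume e: "0 < e"
    define e' where "e' = e * sqrt (a 0) / (tail {} + 1)"
    have s: "0 < sqrt (a 0)" using a_pos[of 0] by simp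
    have e': "0 < e'" using e s t by (simp add: e'_def)
    then obtain N where N: "\<And>m n. m \<ge> N \<Longrightarrow> n \<ge> N \<Longrightarrow> d m n < e'"
      using w unfolding d_def by meson
    have "norm (vdist Y (w n) (ae_class V) - 0) < e" if n: "N \<le> n" for n
    proof -
      have B: "(\<lambda>\<omega>. U n \<omega> + (- 1) * V \<omega>) \<in> ess_bounded M"
        by (rule ess_bounded_add[OF U(1) ess_bounded_cmult[OF VB]])
      have "dual_norm M T a (\<lambda>\<omega>. U n \<omega> + (- 1) * V \<omega>) \<le> tail {} * e' / sqrt (a 0)"
        using near[of e' N n] N e' n t by (intro dual_norm_le_bound B) auto
      also have "\<dots> < e"
        using e s t by (simp add: e'_def pos_divide_less_eq)
      finally show ?thesis
        using dual_norm_nonneg[OF B] by (simp only: U(2) vdist_ae_class[OF U(1) VB]) simp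
    qed
    then show "\<exists>N. \<forall>n\<ge>N. norm (vdist Y (w n) (ae_class V) - 0) < e" by blast
  qed
qed

text \<open>A rank-one operator has the form \<open>\<Phi> \<mapsto> F(\<Phi>) \<Psi>\<close> with \<open>|||\<Psi>|||\<^sub>* = 1\<close> after rescaling, and then its
  norm is that of \<open>F\<close>. The lower estimate for \<open>I + R\<close> tests it on the perturbation \<open>\<Phi>'\<close> of
  \<open>daugavet_perturbation\<close>, divided by \<open>1 + e\<close> to return to the unit ball, and lets \<open>e\<close> tend to 0.\<close>
lemma operator_norm_id_plus_rank_one:
  assumes R: "bounded_operator_on Y R" and rank: "rank_one_on Y R"
  shows "operator_norm_on Y (\<lambda>x. vadd Y x (R x)) = 1 + operator_norm_on Y R"
proof -
  let ?dn = "dual_norm M T a"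
  have R_carrier: "\<And>x. x \<in> vcarrier Y \<Longrightarrow> R x \<in> vcarrier Y"
    and R_add: "\<And>x y. x \<in> vcarrier Y \<Longrightarrow> y \<in> vcarrier Y \<Longrightarrow> R (vadd Y x y) = vadd Y (R x) (R y)"
    and R_scale: "\<And>c x. x \<in> vcarrier Y \<Longrightarrow> R (vscale Y c x) = vscale Y c (R x)"
    using R by (auto simp: bounded_operator_on_def)
  obtain C0 where C0: "\<And>x. x \<in> vcarrier Y \<Longrightarrow> vnorm Y (R x) \<le> C0 * vnorm Y x"
    using R unfolding bounded_operator_on_def by blast
  obtain y where y: "y \<in> vcarrier Y" "y \<noteq> vzero Y" "R ` vcarrier Y = range (\<lambda>c. vscale Y c y)"
    using rank by (auto simp: rank_one_on_def)
  obtain \<Psi>0 where \<Psi>0: "\<Psi>0 \<in> ess_bounded M" "y = ae_class \<Psi>0"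
    using y(1) by (rule vcarrier_cases)
  define D where "D = ?dn \<Psi>0"
  have "D \<noteq> 0"
    using y(2) \<Psi>0 by (simp add: D_def vzero_eq ae_class_eq_iff dual_norm_eq_zero_iff ess_bounded_zero)
  then have D: "0 < D" using dual_norm_nonneg[OF \<Psi>0(1)] by (simp add: D_def)
  define \<Psi> where "\<Psi> \<omega> = of_real (1 / D) * \<Psi>0 \<omega>" for \<omega>
  have \<Psi>: "\<Psi> \<in> ess_bounded M"
    unfolding \<Psi>_def[abs_def] by (rule ess_bounded_cmult[OF \<Psi>0(1)])
  have dn_\<Psi>: "?dn \<Psi> = 1"
    unfolding \<Psi>_def[abs_def] dual_norm_cmult[OF \<Psi>0(1)] norm_of_real
    using D by (simp add: D_def[symmetric])
  have scaled: "(\<lambda>\<omega>. c * \<Psi> \<omega>) \<in> ess_bounded M" for c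
    by (rule ess_bounded_cmult[OF \<Psi>])
  define F where "F \<Phi> = (SOME c. R (ae_class \<Phi>) = ae_class (\<lambda>\<omega>. c * \<Psi> \<omega>))" for \<Phi>
  have F: "R (ae_class \<Phi>) = ae_class (\<lambda>\<omega>. F \<Phi> * \<Psi> \<omega>)" if "\<Phi> \<in> ess_bounded M" for \<Phi>
  proof -
    have "R (ae_class \<Phi>) \<in> range (\<lambda>c. vscale Y c y)"
      using y(3) ae_class_carrier[OF that] by blast
    then obtain c where "R (ae_class \<Phi>) = ae_class (\<lambda>\<omega>. c * \<Psi>0 \<omega>)"
      using \<Psi>0 by (auto simp: vscale_ae_class)
    also have "(\<lambda>\<omega>. c * \<Psi>0 \<omega>) = (\<lambda>\<omega>. c * of_real D * \<Psi> \<omega>)"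
      using D by (auto simp: \<Psi>_def)
    finally show ?thesis
      unfolding F_def by (rule someI)
  qed
  \<comment> \<open>The coefficient of \<open>\<Psi>\<close> is determined, which makes \<open>F\<close> linear.\<close>
  have unique: "b = c" if "ae_class (\<lambda>\<omega>. b * \<Psi> \<omega>) = ae_class (\<lambda>\<omega>. c * \<Psi> \<omega>)" for b c
  proof -
    have "AE \<omega> in M. (b - c) * \<Psi> \<omega> = 0"
      using that by (simp add: ae_class_eq_iff scaled algebra_simps)
    then have "?dn (\<lambda>\<omega>. (b - c) * \<Psi> \<omega>) = 0"
      using dual_norm_eq_zero_iff[OF scaled] by blast
    then show ?thesis
      unfolding dual_norm_cmult[OF \<Psi>] by (simp add: dn_\<Psi>)
  qed
  have F_add: "F (\<lambda>\<omega>. \<Phi> \<omega> + \<Phi>' \<omega>) = F \<Phi> + F \<Phi>'"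
    if "\<Phi> \<in> ess_bounded M" "\<Phi>' \<in> ess_bounded M" for \<Phi> \<Phi>'
  proof (rule unique)
    have "ae_class (\<lambda>\<omega>. F (\<lambda>\<omega>. \<Phi> \<omega> + \<Phi>' \<omega>) * \<Psi> \<omega>) = R (vadd Y (ae_class \<Phi>) (ae_class \<Phi>'))"
      using that by (simp add: vadd_ae_class F ess_bounded_add)
    also have "\<dots> = vadd Y (ae_class (\<lambda>\<omega>. F \<Phi> * \<Psi> \<omega>)) (ae_class (\<lambda>\<omega>. F \<Phi>' * \<Psi> \<omega>))"
      using that by (simp add: R_add ae_class_carrier F)
    also have "\<dots> = ae_class (\<lambda>\<omega>. (F \<Phi> + F \<Phi>') * \<Psi> \<omega>)"
      by (simp add: vadd_ae_class scaled distrib_right)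
    finally show "ae_class (\<lambda>\<omega>. F (\<lambda>\<omega>. \<Phi> \<omega> + \<Phi>' \<omega>) * \<Psi> \<omega>) = ae_class (\<lambda>\<omega>. (F \<Phi> + F \<Phi>') * \<Psi> \<omega>)" .
  qed
  have F_scale: "F (\<lambda>\<omega>. c * \<Phi> \<omega>) = c * F \<Phi>" if "\<Phi> \<in> ess_bounded M" for c \<Phi>
  proof (rule unique)
    have "ae_class (\<lambda>\<omega>. F (\<lambda>\<omega>. c * \<Phi> \<omega>) * \<Psi> \<omega>) = R (vscale Y c (ae_class \<Phi>))"
      using that by (simp add: vscale_ae_class F ess_bounded_cmult)
    also have "\<dots> = vscale Y c (ae_class (\<lambda>\<omega>. F \<Phi> * \<Psi> \<omega>))"
      using that by (simp add: R_scale ae_class_carrier F)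
    also have "\<dots> = ae_class (\<lambda>\<omega>. c * F \<Phi> * \<Psi> \<omega>)"
      by (simp add: vscale_ae_class scaled mult.assoc)
    finally show "ae_class (\<lambda>\<omega>. F (\<lambda>\<omega>. c * \<Phi> \<omega>) * \<Psi> \<omega>) = ae_class (\<lambda>\<omega>. c * F \<Phi> * \<Psi> \<omega>)" .
  qed
  have vnorm_R: "vnorm Y (R (ae_class \<Phi>)) = norm (F \<Phi>)" if "\<Phi> \<in> ess_bounded M" for \<Phi>
    using that by (simp add: F vnorm_ae_class scaled dual_norm_cmult[OF \<Psi>] dn_\<Psi>)
  define C where "C = max C0 0"
  have C: "0 \<le> C" by (simp add: C_def)
  have F_bound: "norm (F \<Phi>) \<le> C * ?dn \<Phi>" if "\<Phi> \<in> ess_bounded M" for \<Phi>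
  proof -
    have "norm (F \<Phi>) \<le> C0 * ?dn \<Phi>"
      using C0[OF ae_class_carrier[OF that]] that by (simp add: vnorm_R vnorm_ae_class)
    also have "\<dots> \<le> C * ?dn \<Phi>"
      using that by (intro mult_right_mono dual_norm_nonneg) (auto simp: C_def)
    finally show ?thesis .
  qed
  have sum: "vadd Y (ae_class \<Phi>) (R (ae_class \<Phi>)) = ae_class (\<lambda>\<omega>. \<Phi> \<omega> + F \<Phi> * \<Psi> \<omega>)"
    if "\<Phi> \<in> ess_bounded M" for \<Phi>
    using that by (simp add: F vadd_ae_class scaled)
  have sumB: "(\<lambda>\<omega>. \<Phi> \<omega> + c * \<Psi> \<omega>) \<in> ess_bounded M" if "\<Phi> \<in> ess_bounded M" for \<Phi> c
    by (rule ess_bounded_add[OF that scaled])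
  have triangle: "?dn (\<lambda>\<omega>. \<Phi> \<omega> + c * \<Psi> \<omega>) \<le> ?dn \<Phi> + norm c" if "\<Phi> \<in> ess_bounded M" for \<Phi> c
    using dual_norm_add[OF that scaled[of c]] by (simp add: dual_norm_cmult[OF \<Psi>] dn_\<Psi>)

  let ?ball = "{x \<in> vcarrier Y. vnorm Y x \<le> 1}"
  have ball: "x \<in> ?ball \<longleftrightarrow> (\<exists>\<Phi>. \<Phi> \<in> ess_bounded M \<and> ?dn \<Phi> \<le> 1 \<and> x = ae_class \<Phi>)" for x
    by (auto simp: vnorm_ae_class ae_class_carrier elim!: vcarrier_cases)
  have zero_ball: "ae_class (\<lambda>_. 0) \<in> ?ball"
    using dual_norm_eq_zero_iff[OF ess_bounded_zero] ess_bounded_zero unfolding ball by force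
  have F_le: "norm (F \<Phi>) \<le> C" if "\<Phi> \<in> ess_bounded M" "?dn \<Phi> \<le> 1" for \<Phi>
    using F_bound[OF that(1)] mult_left_le[OF that(2) C] by linarith
  have bdd_R: "bdd_above ((\<lambda>x. vnorm Y (R x)) ` ?ball)"
    by (rule bdd_aboveI2[of _ _ C]) (auto simp: ball vnorm_R F_le simp del: mem_Collect_eq)
  have bdd_sum: "bdd_above ((\<lambda>x. vnorm Y (vadd Y x (R x))) ` ?ball)"
  proof (rule bdd_aboveI2)
    fix x assume "x \<in> ?ball"
    then obtain \<Phi> where \<Phi>: "\<Phi> \<in> ess_bounded M" "?dn \<Phi> \<le> 1" "x = ae_class \<Phi>"
      unfolding ball by blast
    then show "vnorm Y (vadd Y x (R x)) \<le> 1 + C"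
      using triangle[OF \<Phi>(1), of "F \<Phi>"] F_le[OF \<Phi>(1,2)] by (simp add: sum vnorm_ae_class sumB)
  qed
  define r where "r = operator_norm_on Y R"
  define s where "s = operator_norm_on Y (\<lambda>x. vadd Y x (R x))"
  have r_upper: "norm (F \<Phi>) \<le> r" if "\<Phi> \<in> ess_bounded M" "?dn \<Phi> \<le> 1" for \<Phi>
  proof -
    have "ae_class \<Phi> \<in> ?ball" unfolding ball using that by blast
    from cSUP_upper[OF this bdd_R] show ?thesis
      by (simp add: r_def operator_norm_on_def vnorm_R that)
  qed
  have s_upper: "?dn (\<lambda>\<omega>. \<Phi> \<omega> + F \<Phi> * \<Psi> \<omega>) \<le> s" if "\<Phi> \<in> ess_bounded M" "?dn \<Phi> \<le> 1" for \<Phi>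
  proof -
    have "ae_class \<Phi> \<in> ?ball" unfolding ball using that by blast
    from cSUP_upper[OF this bdd_sum] show ?thesis
      by (simp add: s_def operator_norm_on_def sum vnorm_ae_class sumB that)
  qed
  have "s \<le> 1 + r"
    unfolding s_def operator_norm_on_def
  proof (rule cSUP_least)
    show "?ball \<noteq> {}" using zero_ball by blast
    fix x assume "x \<in> ?ball"
    then obtain \<Phi> where \<Phi>: "\<Phi> \<in> ess_bounded M" "?dn \<Phi> \<le> 1" "x = ae_class \<Phi>"
      unfolding ball by blast
    then show "vnorm Y (vadd Y x (R x)) \<le> 1 + r"
      using triangle[OF \<Phi>(1), of "F \<Phi>"] r_upper[OF \<Phi>(1,2)] by (simp add: sum vnorm_ae_class sumB)
  qed
  moreover have "r \<le> s - 1"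
    unfolding r_def operator_norm_on_def
  proof (rule cSUP_least)
    show "?ball \<noteq> {}" using zero_ball by blast
    fix x assume "x \<in> ?ball"
    then obtain \<Phi> where \<Phi>: "\<Phi> \<in> ess_bounded M" "?dn \<Phi> \<le> 1" "x = ae_class \<Phi>"
      unfolding ball by blast
    define z where "z = norm (F \<Phi>)"
    have est: "(1 + z) * (1 - e) \<le> s * (1 + e) + e" if e: "0 < e" "e < 1" for e
    proof -
      obtain \<Phi>' where \<Phi>': "\<Phi>' \<in> ess_bounded M" "?dn \<Phi>' \<le> 1 + e" "norm (F \<Phi>' - F \<Phi>) \<le> e"
        and big: "(1 + z) * (1 - e) \<le> ?dn (\<lambda>\<omega>. \<Phi>' \<omega> + F \<Phi> * \<Psi> \<omega>)"
        using daugavet_perturbation[of F, OF F_add F_scale F_bound C \<Psi> dn_\<Psi> \<Phi>(1,2) e]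
        unfolding z_def by blast
      let ?t = "of_real (1 / (1 + e)) :: 'k"
      have norm_t: "norm ?t = 1 / (1 + e)"
        using e unfolding norm_of_real by simp
      have "?dn (\<lambda>\<omega>. ?t * \<Phi>' \<omega>) \<le> 1"
        unfolding dual_norm_cmult[OF \<Phi>'(1)] norm_t using \<Phi>'(2) e by (simp add: field_simps)
      then have "?dn (\<lambda>\<omega>. ?t * \<Phi>' \<omega> + F (\<lambda>\<omega>. ?t * \<Phi>' \<omega>) * \<Psi> \<omega>) \<le> s"
        by (intro s_upper ess_bounded_cmult \<Phi>')
      also have "(\<lambda>\<omega>. ?t * \<Phi>' \<omega> + F (\<lambda>\<omega>. ?t * \<Phi>' \<omega>) * \<Psi> \<omega>) = (\<lambda>\<omega>. ?t * (\<Phi>' \<omega> + F \<Phi>' * \<Psi> \<omega>))"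
        unfolding F_scale[OF \<Phi>'(1)] distrib_left mult.assoc ..
      also have "?dn \<dots> = 1 / (1 + e) * ?dn (\<lambda>\<omega>. \<Phi>' \<omega> + F \<Phi>' * \<Psi> \<omega>)"
        unfolding dual_norm_cmult[OF sumB[OF \<Phi>'(1)]] norm_t ..
      finally have le_s: "?dn (\<lambda>\<omega>. \<Phi>' \<omega> + F \<Phi>' * \<Psi> \<omega>) \<le> s * (1 + e)"
        using e by (simp add: field_simps)
      have "(\<lambda>\<omega>. \<Phi>' \<omega> + F \<Phi> * \<Psi> \<omega>) = (\<lambda>\<omega>. \<Phi>' \<omega> + F \<Phi>' * \<Psi> \<omega> + (F \<Phi> - F \<Phi>') * \<Psi> \<omega>)"
        by (simp add: algebra_simps)
      then have "?dn (\<lambda>\<omega>. \<Phi>' \<omega> + F \<Phi> * \<Psi> \<omega>) \<le> ?dn (\<lambda>\<omega>. \<Phi>' \<omega> + F \<Phi>' * \<Psi> \<omega>) + norm (F \<Phi> - F \<Phi>')"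
        using triangle[OF sumB[OF \<Phi>'(1)], of "F \<Phi>'" "F \<Phi> - F \<Phi>'"] by simp
      then show ?thesis
        using big le_s \<Phi>'(3) by (simp add: norm_minus_commute)
    qed
    have z: "0 \<le> z" by (simp add: z_def)
    have s: "0 \<le> s"
      using s_upper[OF \<Phi>(1,2)] dual_norm_nonneg[OF sumB[OF \<Phi>(1)], of "F \<Phi>"] by linarith
    have "1 + z \<le> s"
    proof (rule ccontr)
      define \<delta> where "\<delta> = 1 + z - s"
      assume "\<not> 1 + z \<le> s"
      then have \<delta>: "0 < \<delta>" by (simp add: \<delta>_def)
      \<comment> \<open>The error terms of \<open>est\<close> add up to \<open>e * K\<close>, so \<open>e\<close> is chosen with \<open>e * K\<close> below the gap \<open>\<delta>\<close>.\<close>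
      define K where "K = 2 + z + s"
      have K: "0 < K" "\<delta> < 2 * K" using z s by (auto simp: K_def \<delta>_def)
      define e where "e = \<delta> / (2 * K)"
      have e: "0 < e" "e < 1" and eK: "e * K = \<delta> / 2"
        using \<delta> K by (auto simp: e_def)
      have "\<delta> \<le> e * K"
        using est[OF e] by (simp add: \<delta>_def K_def algebra_simps)
      then show False using \<delta> eK by simp
    qed
    then show "vnorm Y (R x) \<le> s - 1"
      using \<Phi> by (simp add: vnorm_R z_def)
  qed
  ultimately show ?thesis by (simp add: r_def s_def)
qed

end

theorem daugavet_dual_space:
  "daugavet_property (dual_space M T a ::
    ('k::{real_normed_field, banach, second_countable_topology}, ('a \<Rightarrow> 'k) set) normed_structure)"
  unfolding daugavet_property_def
  using banach_space_dual operator_norm_id_plus_rank_one by blast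

end

theorem theorem3p10:
  fixes M :: "'a measure" and T :: "'a \<Rightarrow> 'a" and a :: "int \<Rightarrow> real"
  assumes "prob_space M" and "atomless M"
    and "invertible_mpt M T"
    and "\<And>k. 0 < a k"
    and "(a has_sum 1) UNIV"
    and "(\<lambda>k. sqrt (a k)) summable_on UNIV"
  shows "daugavet_property (dual_space M T a :: (real, ('a \<Rightarrow> real) set) normed_structure)
       \<and> daugavet_property (dual_space M T a :: (complex, ('a \<Rightarrow> complex) set) normed_structure)"
proof -
  interpret prob_space M by (rule assms)
  interpret renormed_L1 M T a
    by unfold_locales (use assms in auto)
  show ?thesis
    by (intro conjI daugavet_dual_space)
qed

end
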